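(* Let $m,n\in\mathbb{N}$ and let $\{u(k,\cdot)\in\mathcal{S}'(\mathbb{R}^n)\}_{k\in\mathbb{Z}^m}$ be a sequence of tempered distributions for which there exist $C,N>0$ such that $$|\langle u(k,x),f(x)\rangle|\leq C\,\tilde{p}_N(f)\,(1+|k|^2)^{N/2}$$ for every $f\in\mathcal{S}(\mathbb{R}^n)$ and every $k\in\mathbb{Z}^m$, where $\tilde{p}_N(f)=\sum_{|\alpha|+|\gamma|\leq N}\|x^\gamma\partial^\alpha f\|_\infty$ (sum over $\alpha,\gamma\in\mathbb{N}_0^n$). Then there exists a unique $\check{u}\in\mathcal{S}'(\mathbb{T}^m\times\mathbb{R}^n)$ such that $$\langle\check{u},f\rangle=(2\pi)^m\sum_{k\in\mathbb{Z}^m}\langle u(k,x),\widehat{f}(-k,x)\rangle=\sum_{k\in\mathbb{Z}^m}\langle u(k,x)e^{ik\cdot t},f(t,x)\rangle$$ for every $f\in\mathcal{S}(\mathbb{T}^m\times\mathbb{R}^n)$.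
   Context: $\mathbb{T}^m=(\mathbb{R}/2\pi\mathbb{Z})^m$, with variables $(t,x)\in\mathbb{T}^m\times\mathbb{R}^n$; $\mathbb{N}_0$ denotes the nonnegative integers; $\mathcal{S}(\mathbb{R}^n)$, $\mathcal{S}'(\mathbb{R}^n)$ are the usual Schwartz space and tempered distributions. $\mathcal{S}(\mathbb{T}^m\times\mathbb{R}^n)$ is the Fréchet space of all $f\in C^\infty(\mathbb{T}^m\times\mathbb{R}^n)$ such that $\|f\|_{\alpha,\beta,\gamma}:=\sup_{(t,x)}|x^\gamma\partial_t^\alpha\partial_x^\beta f(t,x)|<+\infty$ for all $\alpha\in\mathbb{N}_0^m$, $\beta,\gamma\in\mathbb{N}_0^n$, with seminorms $p_N(f):=\sum_{|\alpha|+|\beta|+|\gamma|\leq N}\|f\|_{\alpha,\beta,\gamma}$; $\mathcal{S}'(\mathbb{T}^m\times\mathbb{R}^n)$ is its topological dual. For $f\in\mathcal{S}(\mathbb{T}^m\times\mathbb{R}^n)$ and $k\in\mathbb{Z}^m$, $\widehat{f}(k,x):=\frac{1}{(2\pi)^m}\int_{[0,2\pi]^m}f(t,x)e^{-ik\cdot t}\,dt$. The pairing $\langle u(k,x)e^{ik\cdot t},f(t,x)\rangle$ means $\int_{\mathbb{T}^m}\langle u(k,x),f(t,x)\rangle e^{ik\cdot t}\,dt$, where $dt$ has total mass $(2\pi)^m$. The distribution $\check{u}$ is denoted $\mathcal{F}_{\mathbb{T}^m}^{-1}(u)$. *)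

theory Defs
  imports "HOL-Analysis.Analysis"
begin

section \<open>Smooth functions and partial derivatives\<close>

primrec smooth_upto :: "nat \<Rightarrow> ('a::real_normed_vector \<Rightarrow> complex) \<Rightarrow> bool" where
  "smooth_upto 0 f \<longleftrightarrow> continuous_on UNIV f"
| "smooth_upto (Suc k) f \<longleftrightarrow>
     (\<forall>x. f differentiable (at x)) \<and>
     (\<forall>v. smooth_upto k (\<lambda>x. frechet_derivative f (at x) v))"

definition smooth :: "('a::real_normed_vector \<Rightarrow> complex) \<Rightarrow> bool" where
  "smooth f \<longleftrightarrow> (\<forall>k. smooth_upto k f)"

definition partial_deriv :: "'a::real_normed_vector \<Rightarrow> ('a \<Rightarrow> complex) \<Rightarrow> 'a \<Rightarrow> complex" where
  "partial_deriv v f = (\<lambda>x. frechet_derivative f (at x) v)"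

text \<open>Multi-indices over a finite index type \<open>'i\<close> are functions \<open>'i \<Rightarrow> nat\<close>. The partial
  derivatives of order \<open>\<alpha>\<close> are composed along an arbitrary but fixed enumeration of \<open>'i\<close>;
  on smooth functions, the only place where they are used, the order is irrelevant.\<close>

definition index_list :: "'i::finite list" where
  "index_list = (SOME l. distinct l \<and> set l = UNIV)"

definition multi_deriv ::
    "('i::finite \<Rightarrow> 'a::real_normed_vector) \<Rightarrow> ('i \<Rightarrow> nat) \<Rightarrow> ('a \<Rightarrow> complex) \<Rightarrow> 'a \<Rightarrow> complex" where
  "multi_deriv e \<alpha> f = foldr (\<lambda>i. partial_deriv (e i) ^^ \<alpha> i) index_list f"

definition mi_order :: "('i::finite \<Rightarrow> nat) \<Rightarrow> nat" where
  "mi_order \<alpha> = (\<Sum>i\<in>UNIV. \<alpha> i)"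

definition mi_power :: "real ^ 'n \<Rightarrow> ('n::finite \<Rightarrow> nat) \<Rightarrow> real" where
  "mi_power x \<gamma> = (\<Prod>i\<in>UNIV. (x $ i) ^ \<gamma> i)"


section \<open>Topological dual of a space of functions with a sequence of seminorms\<close>

definition seminorm_topology ::
    "('a \<Rightarrow> complex) set \<Rightarrow> (nat \<Rightarrow> ('a \<Rightarrow> complex) \<Rightarrow> real) \<Rightarrow> ('a \<Rightarrow> complex) topology" where
  "seminorm_topology S p =
     topology_generated_by {{g \<in> S. p N (\<lambda>z. g z - f z) < e} | N f e. f \<in> S \<and> 0 < e}"

text \<open>Functionals are normalised to \<open>undefined\<close> outside the space, so that equality of elements
  of the dual is equality of functionals on the space.\<close>

definition topological_dual ::
    "('a \<Rightarrow> complex) set \<Rightarrow> (nat \<Rightarrow> ('a \<Rightarrow> complex) \<Rightarrow> real) \<Rightarrow> (('a \<Rightarrow> complex) \<Rightarrow> complex) set" where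
  "topological_dual S p =
     {u \<in> extensional S.
        (\<forall>f\<in>S. \<forall>g\<in>S. u (\<lambda>z. f z + g z) = u f + u g) \<and>
        (\<forall>c. \<forall>f\<in>S. u (\<lambda>z. c * f z) = c * u f) \<and>
        continuous_map (seminorm_topology S p) euclidean u}"


section \<open>Schwartz functions and tempered distributions on Euclidean space\<close>

definition weighted_deriv ::
    "('n \<Rightarrow> nat) \<Rightarrow> ('n \<Rightarrow> nat) \<Rightarrow> (real ^ 'n::finite \<Rightarrow> complex) \<Rightarrow> real ^ 'n \<Rightarrow> complex" where
  "weighted_deriv \<alpha> \<gamma> f x = of_real (mi_power x \<gamma>) * multi_deriv (\<lambda>j. axis j 1) \<alpha> f x"

definition schwartz :: "(real ^ 'n::finite \<Rightarrow> complex) set" where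
  "schwartz = {f. smooth f \<and> (\<forall>\<alpha> \<gamma>. bdd_above (range (\<lambda>x. cmod (weighted_deriv \<alpha> \<gamma> f x))))}"

definition schwartz_seminorm :: "nat \<Rightarrow> (real ^ 'n::finite \<Rightarrow> complex) \<Rightarrow> real" where
  "schwartz_seminorm N f =
     (\<Sum>(\<alpha>, \<gamma>)\<in>{(\<alpha>, \<gamma>). mi_order \<alpha> + mi_order \<gamma> \<le> N}. SUP x. cmod (weighted_deriv \<alpha> \<gamma> f x))"

definition tempered_distributions :: "((real ^ 'n::finite \<Rightarrow> complex) \<Rightarrow> complex) set" where
  "tempered_distributions = topological_dual schwartz schwartz_seminorm"


section \<open>Schwartz functions and tempered distributions on torus times Euclidean space\<close>

text \<open>Functions on the product of the torus \<open>(\<real>/2\<pi>\<int>)\<^sup>m\<close> and \<open>\<real>\<^sup>n\<close> are represented by functions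
  on \<open>\<real>\<^sup>m \<times> \<real>\<^sup>n\<close> that are \<open>2\<pi>\<close>-periodic in each of the first \<open>m\<close> variables; smoothness and
  derivatives are those of the periodic representative.\<close>

definition torus_periodic :: "((real ^ 'm::finite) \<times> (real ^ 'n::finite) \<Rightarrow> complex) \<Rightarrow> bool" where
  "torus_periodic f \<longleftrightarrow> (\<forall>t x j. f (t + axis j (2 * pi), x) = f (t, x))"

definition torus_weighted_deriv ::
    "('m \<Rightarrow> nat) \<Rightarrow> ('n \<Rightarrow> nat) \<Rightarrow> ('n \<Rightarrow> nat) \<Rightarrow>
     ((real ^ 'm::finite) \<times> (real ^ 'n::finite) \<Rightarrow> complex) \<Rightarrow> (real ^ 'm) \<times> (real ^ 'n) \<Rightarrow> complex" where
  "torus_weighted_deriv \<alpha> \<beta> \<gamma> f z =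
     of_real (mi_power (snd z) \<gamma>) *
     multi_deriv (\<lambda>i. (axis i 1, 0)) \<alpha> (multi_deriv (\<lambda>j. (0, axis j 1)) \<beta> f) z"

definition torus_schwartz :: "((real ^ 'm::finite) \<times> (real ^ 'n::finite) \<Rightarrow> complex) set" where
  "torus_schwartz =
     {f. torus_periodic f \<and> smooth f \<and>
         (\<forall>\<alpha> \<beta> \<gamma>. bdd_above (range (\<lambda>z. cmod (torus_weighted_deriv \<alpha> \<beta> \<gamma> f z))))}"

definition torus_seminorm :: "nat \<Rightarrow> ((real ^ 'm::finite) \<times> (real ^ 'n::finite) \<Rightarrow> complex) \<Rightarrow> real" where
  "torus_seminorm N f =
     (\<Sum>(\<alpha>, \<beta>, \<gamma>)\<in>{(\<alpha>, \<beta>, \<gamma>). mi_order \<alpha> + mi_order \<beta> + mi_order \<gamma> \<le> N}.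
        SUP z. cmod (torus_weighted_deriv \<alpha> \<beta> \<gamma> f z))"

definition torus_tempered_distributions ::
    "(((real ^ 'm::finite) \<times> (real ^ 'n::finite) \<Rightarrow> complex) \<Rightarrow> complex) set" where
  "torus_tempered_distributions = topological_dual torus_schwartz torus_seminorm"


section \<open>Fourier coefficients in the torus variables\<close>

definition real_vec :: "int ^ 'm \<Rightarrow> real ^ 'm::finite" where
  "real_vec k = (\<chi> j. real_of_int (k $ j))"

definition torus_cell :: "(real ^ 'm::finite) set" where
  "torus_cell = cbox 0 (\<chi> j. 2 * pi)"

definition fourier_coeff ::
    "((real ^ 'm::finite) \<times> (real ^ 'n::finite) \<Rightarrow> complex) \<Rightarrow> int ^ 'm \<Rightarrow> real ^ 'n \<Rightarrow> complex" where
  "fourier_coeff f k x =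
     1 / of_real ((2 * pi) ^ CARD('m)) *
     integral torus_cell (\<lambda>t. f (t, x) * exp (- (\<i> * of_real (real_vec k \<bullet> t))))"

text \<open>The integrand of the pairing of \<open>w(x) e\<^sup>i\<^sup>k\<^sup>t\<close> with \<open>f(t,x)\<close>: the distribution \<open>w\<close>
  acts on \<open>f(t, \<cdot>)\<close> for each fixed \<open>t\<close>.\<close>

definition pairing_integrand ::
    "((real ^ 'n::finite \<Rightarrow> complex) \<Rightarrow> complex) \<Rightarrow> int ^ 'm \<Rightarrow>
     ((real ^ 'm::finite) \<times> (real ^ 'n) \<Rightarrow> complex) \<Rightarrow> real ^ 'm \<Rightarrow> complex" where
  "pairing_integrand w k f t = w (\<lambda>x. f (t, x)) * exp (\<i> * of_real (real_vec k \<bullet> t))"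

definition exp_pairing ::
    "((real ^ 'n::finite \<Rightarrow> complex) \<Rightarrow> complex) \<Rightarrow> int ^ 'm \<Rightarrow>
     ((real ^ 'm::finite) \<times> (real ^ 'n) \<Rightarrow> complex) \<Rightarrow> complex" where
  "exp_pairing w k f = integral torus_cell (pairing_integrand w k f)"

end

theory Submission
  imports Defs
begin

text \<open>Write \<open>e\<^sub>k(t) = exp(i k\<cdot>t)\<close> and \<open>I\<^sub>k f(x) = \<integral> f(t,x) e\<^sub>k(t) dt\<close>, the integral being over the
  torus. Up to the factor \<open>(2\<pi>)\<^sup>m\<close> this is the Fourier coefficient of \<open>f\<close> at \<open>-k\<close>. There is one
  candidate for the distribution, \<open>v f = \<Sum>\<^sub>k \<langle>u(k), I\<^sub>k f\<rangle>\<close>, which gives uniqueness at once. For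
  existence there are three things to see.

  First, \<open>I\<^sub>k f\<close> is a Schwartz function that decays rapidly in \<open>k\<close>. Derivatives in \<open>x\<close> pass under
  the integral (\<open>torus_integral_has_derivative\<close>), and periodicity permits integration by parts
  in \<open>t\<close> (\<open>torus_integral_by_parts\<close>), so each power of \<open>k\<^sub>i\<close> costs one derivative of \<open>f\<close>. Hence
  \<open>(1 + |k|\<^sup>2)\<^sup>r\<close> times a Schwartz seminorm of \<open>I\<^sub>k f\<close> is bounded by one seminorm of \<open>f\<close>
  (\<open>schwartz_seminorm_torus_integral_decay\<close>).

  Second, the growth of \<open>u(k)\<close> in \<open>k\<close> is polynomial, so a large \<open>r\<close> leaves the factor
  \<open>(1 + |k|\<^sup>2)\<^sup>-\<^sup>m\<close>, which is summable over \<open>\<int>\<^sup>m\<close> (\<open>summable_on_lattice\<close>). The series converges absolutely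
  and is bounded by one seminorm of \<open>f\<close>, which for a linear functional is continuity
  (\<open>continuous_map_seminorm_topology\<close>).

  Third, both series in the claim are the same termwise: \<open>\<langle>u(k), I\<^sub>k f\<rangle> = \<integral> \<langle>u(k), f(t,\<cdot>)\<rangle> e\<^sub>k(t) dt\<close>.
  This exchange of a functional and an integral (\<open>has_integral_functional_slices\<close>) is obtained from
  Riemann sums, since \<open>t \<mapsto> f(t,\<cdot>)\<close> is Lipschitz into Schwartz space for every seminorm.\<close>


section \<open>Smooth functions and iterated partial derivatives\<close>

lemma smooth_differentiable:
  assumes "smooth f"
  shows "f differentiable (at x)"
proof -
  have "smooth_upto (Suc 0) f"
    using assms unfolding smooth_def by blast
  then show ?thesis by simp
qed

lemma smooth_has_derivative:
  assumes "smooth f"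
  shows "(f has_derivative (\<lambda>v. partial_deriv v f x)) (at x)"
  using smooth_differentiable[OF assms, of x]
  unfolding partial_deriv_def frechet_derivative_works by simp

lemma smooth_continuous_on:
  assumes "smooth f"
  shows "continuous_on A f"
  using assms unfolding smooth_def
  by (metis continuous_on_subset smooth_upto.simps(1) subset_UNIV)

lemma continuous_on_smooth:
  assumes "smooth f" "continuous_on A g"
  shows "continuous_on A (\<lambda>z. f (g z))"
  by (rule continuous_on_compose2[OF smooth_continuous_on[OF assms(1), of UNIV] assms(2)]) auto

lemma smooth_partial_deriv:
  assumes "smooth f"
  shows "smooth (partial_deriv v f)"
  unfolding smooth_def
proof
  fix k
  have "smooth_upto (Suc k) f"
    using assms unfolding smooth_def by blast
  then show "smooth_upto k (partial_deriv v f)"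
    unfolding partial_deriv_def by simp
qed

text \<open>Smoothness is the largest property of functions that implies differentiability and is
  inherited by all directional derivatives. Every closure property below is proved by exhibiting
  such a property.\<close>

lemma smooth_coinduct:
  assumes "P f"
    and "\<And>g x. P g \<Longrightarrow> g differentiable (at x)"
    and "\<And>g v. P g \<Longrightarrow> P (partial_deriv v g)"
  shows "smooth f"
  unfolding smooth_def
proof
  fix k
  have "smooth_upto k g" if "P g" for g
    using that
  proof (induction k arbitrary: g)
    case 0
    then show ?case
      using assms(2) by (auto intro!: differentiable_imp_continuous_on simp: differentiable_on_def
          differentiable_at_withinI)
  next
    case (Suc k)
    then show ?case
      using assms(2,3) by (simp add: partial_deriv_def)
  qed
  then show "smooth_upto k f"
    using assms(1) .
qed

lemma partial_deriv_eqI: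
  assumes "\<And>x. (f has_derivative f' x) (at x)"
  shows "partial_deriv v f = (\<lambda>x. f' x v)"
  unfolding partial_deriv_def using frechet_derivative_at[OF assms] by metis

lemma has_derivative_lincomb:
  fixes f g :: "'a::real_normed_vector \<Rightarrow> complex"
  assumes "smooth f" "smooth g"
  shows "((\<lambda>x. a * f x + b * g x) has_derivative
           (\<lambda>v. a * partial_deriv v f x + b * partial_deriv v g x)) (at x)"
  using smooth_has_derivative[OF assms(1), of x] smooth_has_derivative[OF assms(2), of x]
  by (auto intro!: derivative_eq_intros)

lemma partial_deriv_lincomb:
  fixes f g :: "'a::real_normed_vector \<Rightarrow> complex"
  assumes "smooth f" "smooth g"
  shows "partial_deriv v (\<lambda>x. a * f x + b * g x)
         = (\<lambda>x. a * partial_deriv v f x + b * partial_deriv v g x)"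
  by (rule partial_deriv_eqI) (rule has_derivative_lincomb[OF assms])

lemma smooth_lincomb:
  fixes f g :: "'a::real_normed_vector \<Rightarrow> complex"
  assumes "smooth f" "smooth g"
  shows "smooth (\<lambda>x. a * f x + b * g x)"
proof (rule smooth_coinduct[where P = "\<lambda>h. \<exists>f g. smooth f \<and> smooth g \<and> h = (\<lambda>x. a * f x + b * g x)"])
  show "\<exists>f' g'. smooth f' \<and> smooth g' \<and> (\<lambda>x. a * f x + b * g x) = (\<lambda>x. a * f' x + b * g' x)"
    using assms by blast
  show "h differentiable (at x)"
    if "\<exists>f g. smooth f \<and> smooth g \<and> h = (\<lambda>x. a * f x + b * g x)" for h :: "'a \<Rightarrow> complex" and x
    using that has_derivative_lincomb differentiableI by blast
  show "\<exists>f g. smooth f \<and> smooth g \<and> partial_deriv v h = (\<lambda>x. a * f x + b * g x)"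
    if "\<exists>f g. smooth f \<and> smooth g \<and> h = (\<lambda>x. a * f x + b * g x)" for h :: "'a \<Rightarrow> complex" and v
    using that partial_deriv_lincomb smooth_partial_deriv by metis
qed

lemma smooth_zero: "smooth (\<lambda>x :: 'a::real_normed_vector. 0)"
proof (rule smooth_coinduct[where P = "\<lambda>h. h = (\<lambda>x. 0)"])
  show "partial_deriv v g = (\<lambda>x. 0)" if "g = (\<lambda>x. 0)" for g :: "'a \<Rightarrow> complex" and v
    unfolding that by (rule partial_deriv_eqI[where f' = "\<lambda>_ _. 0"]) simp
qed auto

text \<open>An iterated partial derivative is a composition of first order ones, so every relation
  between functions that survives one differentiation survives them all. The two sides may
  live on different spaces and be differentiated in different directions.\<close>

lemma multi_deriv_related:
  assumes "R f g"
    and "\<And>i f g. R f g \<Longrightarrow> R (partial_deriv (e i) f) (partial_deriv (e' i) g)"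
  shows "R (multi_deriv e \<alpha> f) (multi_deriv e' \<alpha> g)"
proof -
  have pow: "R ((partial_deriv (e i) ^^ n) f) ((partial_deriv (e' i) ^^ n) g)"
    if "R f g" for i n f g
    using that by (induction n) (auto intro: assms(2))
  have "R (foldr (\<lambda>i. partial_deriv (e i) ^^ \<alpha> i) is f) (foldr (\<lambda>i. partial_deriv (e' i) ^^ \<alpha> i) is g)"
    for "is"
    by (induction "is") (auto intro: assms(1) pow)
  then show ?thesis
    unfolding multi_deriv_def .
qed

lemma multi_deriv_invariant:
  assumes "P f"
    and "\<And>i f. P f \<Longrightarrow> P (partial_deriv (e i) f)"
  shows "P (multi_deriv e \<alpha> f)"
  using multi_deriv_related[of "\<lambda>f g. P f" f f e e] assms by blast

lemma multi_deriv_intertwine: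
  assumes "P f"
    and "\<And>i f. P f \<Longrightarrow> P (partial_deriv (e i) f)"
    and "\<And>i f. P f \<Longrightarrow> partial_deriv (e' i) (T f) = T (partial_deriv (e i) f)"
  shows "multi_deriv e' \<alpha> (T f) = T (multi_deriv e \<alpha> f)"
  using multi_deriv_related[of "\<lambda>f g. P f \<and> g = T f" f "T f" e e'] assms by blast

lemma smooth_multi_deriv:
  assumes "smooth f"
  shows "smooth (multi_deriv e \<alpha> f)"
  using assms smooth_partial_deriv by (rule multi_deriv_invariant)

lemma multi_deriv_lincomb:
  fixes f g :: "'b::real_normed_vector \<Rightarrow> complex"
  assumes "smooth f" "smooth g"
  shows "multi_deriv e \<alpha> (\<lambda>x. a * f x + b * g x)
         = (\<lambda>x. a * multi_deriv e \<alpha> f x + b * multi_deriv e \<alpha> g x)"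
proof -
  have pow: "(partial_deriv v ^^ n) (\<lambda>x. a * f x + b * g x)
        = (\<lambda>x. a * (partial_deriv v ^^ n) f x + b * (partial_deriv v ^^ n) g x)
      \<and> smooth ((partial_deriv v ^^ n) f) \<and> smooth ((partial_deriv v ^^ n) g)"
    if "smooth f" "smooth g" for v n and f g :: "'b \<Rightarrow> complex"
    using that by (induction n) (auto simp: partial_deriv_lincomb smooth_partial_deriv)
  have "foldr (\<lambda>i. partial_deriv (e i) ^^ \<alpha> i) is (\<lambda>x. a * f x + b * g x)
        = (\<lambda>x. a * foldr (\<lambda>i. partial_deriv (e i) ^^ \<alpha> i) is f x
             + b * foldr (\<lambda>i. partial_deriv (e i) ^^ \<alpha> i) is g x)
      \<and> smooth (foldr (\<lambda>i. partial_deriv (e i) ^^ \<alpha> i) is f)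
      \<and> smooth (foldr (\<lambda>i. partial_deriv (e i) ^^ \<alpha> i) is g)" for "is"
    using assms by (induction "is") (auto simp: pow)
  then show ?thesis
    unfolding multi_deriv_def by blast
qed

lemma index_list_enumerates: "distinct (index_list :: 'i::finite list) \<and> set (index_list :: 'i list) = UNIV"
proof -
  have "\<exists>l :: 'i list. distinct l \<and> set l = UNIV"
    using finite_distinct_list[OF finite[of "UNIV :: 'i set"]] by blast
  then show ?thesis
    unfolding index_list_def by (rule someI_ex)
qed

lemma multi_deriv_zero: "multi_deriv e (\<lambda>i. 0) f = f"
proof -
  have "foldr (\<lambda>i. partial_deriv (e i) ^^ 0) is f = f" for "is"
    by (induction "is") auto
  then show ?thesis unfolding multi_deriv_def .
qed

text \<open>The pure derivatives in one coordinate direction are the only torus derivatives that the decay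
  of the Fourier coefficients requires.\<close>

lemma multi_deriv_single:
  fixes i :: "'a::finite"
  shows
  "multi_deriv e (\<lambda>j. if j = i then r else 0) f = (partial_deriv (e i) ^^ r) f"
proof -
  have "foldr (\<lambda>j. partial_deriv (e j) ^^ (if j = i then r else 0)) is f
        = (if i \<in> set is then (partial_deriv (e i) ^^ r) f else f)" if "distinct is" for "is"
    using that by (induction "is") auto
  then show ?thesis
    unfolding multi_deriv_def using index_list_enumerates[where 'i = 'a] by simp
qed

lemma mi_order_zero: "mi_order (\<lambda>i. 0) = 0"
  by (simp add: mi_order_def)

lemma mi_order_single: "mi_order (\<lambda>j. if j = i then r else 0) = r"
  by (simp add: mi_order_def)

lemma finite_mi_order: "finite {\<alpha> :: 'i::finite \<Rightarrow> nat. mi_order \<alpha> \<le> N}"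
proof (rule finite_subset)
  show "{\<alpha> :: 'i \<Rightarrow> nat. mi_order \<alpha> \<le> N} \<subseteq> (\<Pi>\<^sub>E i\<in>UNIV. {..N})"
  proof
    fix \<alpha> :: "'i \<Rightarrow> nat"
    assume "\<alpha> \<in> {\<alpha>. mi_order \<alpha> \<le> N}"
    moreover have "\<alpha> i \<le> mi_order \<alpha>" for i
      unfolding mi_order_def by (rule member_le_sum) auto
    ultimately show "\<alpha> \<in> (\<Pi>\<^sub>E i\<in>UNIV. {..N})"
      by (auto simp: PiE_iff intro: order_trans)
  qed
  show "finite (\<Pi>\<^sub>E i\<in>(UNIV :: 'i set). {..N})"
    by (rule finite_PiE) auto
qed


section \<open>The Schwartz spaces and their seminorms\<close>

lemma weighted_deriv_lincomb:
  assumes "smooth f" "smooth g"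
  shows "weighted_deriv \<alpha> \<gamma> (\<lambda>x. a * f x + b * g x) x
         = a * weighted_deriv \<alpha> \<gamma> f x + b * weighted_deriv \<alpha> \<gamma> g x"
  unfolding weighted_deriv_def multi_deriv_lincomb[OF assms] by (simp add: algebra_simps)

lemma torus_weighted_deriv_lincomb:
  assumes "smooth f" "smooth g"
  shows "torus_weighted_deriv \<alpha> \<beta> \<gamma> (\<lambda>z. a * f z + b * g z) z
         = a * torus_weighted_deriv \<alpha> \<beta> \<gamma> f z + b * torus_weighted_deriv \<alpha> \<beta> \<gamma> g z"
  unfolding torus_weighted_deriv_def multi_deriv_lincomb[OF assms]
    multi_deriv_lincomb[OF smooth_multi_deriv[OF assms(1)] smooth_multi_deriv[OF assms(2)]]
  by (simp add: algebra_simps)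

lemma bdd_above_cmod_lincomb:
  assumes "bdd_above (range (\<lambda>x. cmod (F x)))" "bdd_above (range (\<lambda>x. cmod (G x)))"
  shows "bdd_above (range (\<lambda>x. cmod (a * F x + b * G x)))"
proof -
  obtain A B where "\<And>x. cmod (F x) \<le> A" "\<And>x. cmod (G x) \<le> B"
    using assms unfolding bdd_above_def by auto
  then have "cmod (a * F x + b * G x) \<le> cmod a * A + cmod b * B" for x
    by (metis add_mono mult_left_mono norm_ge_zero norm_mult norm_triangle_le)
  then show ?thesis
    by (auto intro!: bdd_aboveI)
qed

lemma schwartz_lincomb:
  assumes "f \<in> schwartz" "g \<in> schwartz"
  shows "(\<lambda>x. a * f x + b * g x) \<in> schwartz"
  using assms unfolding schwartz_def
  by (simp add: smooth_lincomb weighted_deriv_lincomb bdd_above_cmod_lincomb)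

lemma torus_schwartz_lincomb:
  assumes "f \<in> torus_schwartz" "g \<in> torus_schwartz"
  shows "(\<lambda>z. a * f z + b * g z) \<in> torus_schwartz"
  using assms unfolding torus_schwartz_def torus_periodic_def
  by (simp add: smooth_lincomb torus_weighted_deriv_lincomb bdd_above_cmod_lincomb)

lemma weighted_deriv_zero: "weighted_deriv \<alpha> \<gamma> (\<lambda>x. 0) x = 0"
  using weighted_deriv_lincomb[OF smooth_zero smooth_zero, of \<alpha> \<gamma> 0 0] by simp

lemma schwartz_zero: "(\<lambda>x. 0) \<in> schwartz"
  unfolding schwartz_def by (simp add: smooth_zero weighted_deriv_zero)

lemma schwartz_sum:
  assumes "finite I" "\<And>i. i \<in> I \<Longrightarrow> F i \<in> schwartz"
  shows "(\<lambda>x. \<Sum>i\<in>I. a i * F i x) \<in> schwartz"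
  using assms
proof (induction I rule: finite_induct)
  case (insert j I)
  then show ?case
    using schwartz_lincomb[of "F j" "\<lambda>x. \<Sum>i\<in>I. a i * F i x" "a j" 1] by simp
qed (simp add: schwartz_zero)

lemma weighted_deriv_sum:
  assumes "finite I" "\<And>i. i \<in> I \<Longrightarrow> F i \<in> schwartz"
  shows "weighted_deriv \<alpha> \<gamma> (\<lambda>x. \<Sum>i\<in>I. a i * F i x) x = (\<Sum>i\<in>I. a i * weighted_deriv \<alpha> \<gamma> (F i) x)"
  using assms
proof (induction I rule: finite_induct)
  case (insert j I)
  then have "F j \<in> schwartz" "(\<lambda>x. \<Sum>i\<in>I. a i * F i x) \<in> schwartz"
    using schwartz_sum[of I F a] by auto
  with insert show ?case
    using weighted_deriv_lincomb[of "F j" "\<lambda>x. \<Sum>i\<in>I. a i * F i x" \<alpha> \<gamma> "a j" 1]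
    by (simp add: schwartz_def)
qed (simp add: weighted_deriv_zero)

lemma finite_torus_orders:
  "finite {(\<alpha> :: 'm::finite \<Rightarrow> nat, \<beta> :: 'n::finite \<Rightarrow> nat, \<gamma> :: 'n \<Rightarrow> nat).
      mi_order \<alpha> + mi_order \<beta> + mi_order \<gamma> \<le> N}"
proof (rule finite_subset)
  show "{(\<alpha> :: 'm \<Rightarrow> nat, \<beta> :: 'n \<Rightarrow> nat, \<gamma> :: 'n \<Rightarrow> nat).
          mi_order \<alpha> + mi_order \<beta> + mi_order \<gamma> \<le> N}
        \<subseteq> {\<alpha>. mi_order \<alpha> \<le> N} \<times> {\<beta>. mi_order \<beta> \<le> N} \<times> {\<gamma>. mi_order \<gamma> \<le> N}"
    by (rule subsetI) (simp add: case_prod_unfold mem_Times_iff)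
qed (rule finite_cartesian_product, rule finite_mi_order,
    rule finite_cartesian_product; rule finite_mi_order)

definition schwartz_order_count :: "'n::finite itself \<Rightarrow> nat \<Rightarrow> nat" where
  "schwartz_order_count _ N = card {(\<alpha> :: 'n \<Rightarrow> nat, \<gamma> :: 'n \<Rightarrow> nat). mi_order \<alpha> + mi_order \<gamma> \<le> N}"

lemma schwartz_seminorm_le:
  fixes f :: "real ^ 'n::finite \<Rightarrow> complex"
  assumes "\<And>\<alpha> \<gamma> x. mi_order \<alpha> + mi_order \<gamma> \<le> N \<Longrightarrow> cmod (weighted_deriv \<alpha> \<gamma> f x) \<le> B"
  shows "schwartz_seminorm N f \<le> real (schwartz_order_count TYPE('n) N) * B"
  unfolding schwartz_seminorm_def schwartz_order_count_def
  by (rule sum_bounded_above) (auto intro!: cSUP_least assms)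

text \<open>A sum over an infinite set of indices would be zero, and no term could be estimated by it:
  this is where finiteness of the set of orders up to \<open>N\<close> enters.\<close>

lemma torus_weighted_deriv_le_seminorm:
  fixes f :: "(real ^ 'm::finite) \<times> (real ^ 'n::finite) \<Rightarrow> complex"
  assumes f: "f \<in> torus_schwartz" and N: "mi_order \<alpha> + mi_order \<beta> + mi_order \<gamma> \<le> N"
  shows "cmod (torus_weighted_deriv \<alpha> \<beta> \<gamma> f z) \<le> torus_seminorm N f"
proof -
  let ?S = "\<lambda>(\<alpha>, \<beta>, \<gamma>). SUP z. cmod (torus_weighted_deriv \<alpha> \<beta> \<gamma> f z)"
  have bdd: "bdd_above (range (\<lambda>z. cmod (torus_weighted_deriv \<alpha> \<beta> \<gamma> f z)))" for \<alpha> \<beta> \<gamma>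
    using f unfolding torus_schwartz_def by simp
  have le: "cmod (torus_weighted_deriv \<alpha> \<beta> \<gamma> f z) \<le> ?S (\<alpha>, \<beta>, \<gamma>)" for \<alpha> \<beta> \<gamma> z
    using bdd by (auto intro: cSUP_upper)
  have nonneg: "0 \<le> ?S q" for q
    using order_trans[OF norm_ge_zero le] by (cases q) auto
  have "?S (\<alpha>, \<beta>, \<gamma>) \<le> torus_seminorm N f"
    unfolding torus_seminorm_def
    by (rule member_le_sum) (use N nonneg finite_torus_orders in auto)
  with le show ?thesis
    using order_trans by blast
qed

lemma torus_seminorm_nonneg:
  assumes "f \<in> torus_schwartz"
  shows "0 \<le> torus_seminorm N f"
  by (rule order_trans[OF norm_ge_zero
        torus_weighted_deriv_le_seminorm[OF assms, of "\<lambda>_. 0" "\<lambda>_. 0" "\<lambda>_. 0"]])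
     (simp add: mi_order_zero)


lemma torus_seminorm_zero: "torus_seminorm N (\<lambda>z. 0) = 0"
proof -
  have "torus_weighted_deriv \<alpha> \<beta> \<gamma> (\<lambda>z. 0) z = 0"
    for \<alpha> :: "'a \<Rightarrow> nat" and \<beta> \<gamma> :: "'b \<Rightarrow> nat" and z
    using torus_weighted_deriv_lincomb[OF smooth_zero smooth_zero, of \<alpha> \<beta> \<gamma> 0 0] by simp
  then show ?thesis
    unfolding torus_seminorm_def by (simp add: case_prod_unfold)
qed


section \<open>Weighted integrals over the torus\<close>

text \<open>Fourier coefficients and pairings with exponentials are both integrals of this kind. The
  weight \<open>c\<close> depends on the torus variables only, so it passes through all derivatives in \<open>x\<close>.\<close>

definition torus_integral ::
    "(real ^ 'm::finite \<Rightarrow> complex) \<Rightarrow> ((real ^ 'm) \<times> (real ^ 'n::finite) \<Rightarrow> complex) \<Rightarrow> real ^ 'n \<Rightarrow> complex"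
  where "torus_integral c f x = integral torus_cell (\<lambda>t. f (t, x) * c t)"

lemma smooth_slice_integrable:
  fixes f :: "(real ^ 'm::finite) \<times> (real ^ 'n::finite) \<Rightarrow> complex"
  assumes "smooth f" "continuous_on UNIV c"
  shows "(\<lambda>t. f (t, x) * c t) integrable_on cbox a b"
proof (rule integrable_continuous)
  have "continuous_on UNIV (\<lambda>t. f (t, x))"
    by (rule continuous_on_smooth[OF assms(1)]) (intro continuous_intros)
  then show "continuous_on (cbox a b) (\<lambda>t. f (t, x) * c t)"
    using assms(2) by (intro continuous_on_mult) (blast intro: continuous_on_subset)+
qed

lemma slice_has_derivative:
  assumes "smooth f"
  shows "((\<lambda>x. f (t, x)) has_derivative (\<lambda>v. partial_deriv (0, v) f (t, x))) (at x)"
proof -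
  have "((\<lambda>x. (t, x)) has_derivative (\<lambda>v. (0, v))) (at x)"
    by (auto intro!: derivative_eq_intros)
  from has_derivative_compose[OF this smooth_has_derivative[OF assms]]
  show ?thesis .
qed

text \<open>Differentiation under the integral sign needs the derivative to be continuous in the
  operator norm. In finite dimension it is enough that its values on the basis vectors are
  continuous, and these are again smooth functions.\<close>

lemma torus_integral_has_derivative:
  fixes f :: "(real ^ 'm::finite) \<times> (real ^ 'n::finite) \<Rightarrow> complex"
  assumes f: "smooth f" and c: "continuous_on UNIV c"
  shows "(torus_integral c f has_derivative (\<lambda>v. torus_integral c (partial_deriv (0, v) f) x)) (at x)"
proof -
  define D where "D = (\<lambda>x t. Blinfun (\<lambda>v. partial_deriv (0, v) f (t, x) * c t))"
  have D: "blinfun_apply (D x t) = (\<lambda>v. partial_deriv (0, v) f (t, x) * c t)" for x t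
    unfolding D_def
    by (rule bounded_linear_Blinfun_apply, rule bounded_linear_mult_const,
        rule has_derivative_bounded_linear, rule slice_has_derivative[OF f])
  have cont: "continuous_on (UNIV \<times> cbox a b) (\<lambda>(x, t). D x t)" for a b :: "real ^ 'm"
    unfolding case_prod_unfold
  proof (rule continuous_on_blinfun_componentwise)
    fix i :: "real ^ 'n"
    have "continuous_on (UNIV \<times> cbox a b) (\<lambda>z. partial_deriv (0, i) f (snd z, fst z))"
      by (rule continuous_on_smooth[OF smooth_partial_deriv[OF f]]) (intro continuous_intros)
    moreover have "continuous_on (UNIV \<times> cbox a b) (\<lambda>z :: (real ^ 'n) \<times> (real ^ 'm). c (snd z))"
      by (rule continuous_on_compose2[OF c]) (auto intro!: continuous_intros)
    ultimately show "continuous_on (UNIV \<times> cbox a b) (\<lambda>z. blinfun_apply (D (fst z) (snd z)) i)"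
      unfolding D by (intro continuous_on_mult)
  qed
  have integrable: "D x integrable_on cbox a b" for a b
  proof (rule integrable_continuous)
    have "continuous_on (cbox a b) (\<lambda>t. case (x, t) of (x, t) \<Rightarrow> D x t)"
      by (rule continuous_on_compose2[OF cont[of a b]]) (auto intro!: continuous_intros)
    then show "continuous_on (cbox a b) (D x)" by simp
  qed
  have "((\<lambda>x. integral torus_cell (\<lambda>t. f (t, x) * c t))
          has_derivative blinfun_apply (integral torus_cell (D x))) (at x within UNIV)"
    unfolding torus_cell_def
  proof (rule leibniz_rule[where U = UNIV and fx = D])
    show "((\<lambda>x. f (t, x) * c t) has_derivative blinfun_apply (D x t)) (at x within UNIV)" for x t
      unfolding D by (rule has_derivative_mult_left) (rule slice_has_derivative[OF f])
  qed (auto intro: smooth_slice_integrable[OF assms] cont)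
  moreover have "blinfun_apply (integral torus_cell (D x))
      = (\<lambda>v. integral torus_cell (\<lambda>t. partial_deriv (0, v) f (t, x) * c t))"
    unfolding torus_cell_def blinfun_apply_integral[OF integrable] D ..
  ultimately show ?thesis
    unfolding torus_integral_def by simp
qed

lemma partial_deriv_torus_integral:
  assumes "smooth f" "continuous_on UNIV c"
  shows "partial_deriv v (torus_integral c f) = torus_integral c (partial_deriv (0, v) f)"
  by (rule partial_deriv_eqI) (rule torus_integral_has_derivative[OF assms])

lemma smooth_torus_integral:
  assumes "smooth f" "continuous_on UNIV c"
  shows "smooth (torus_integral c f)"
proof (rule smooth_coinduct[where P = "\<lambda>h. \<exists>f. smooth f \<and> h = torus_integral c f"])
  show "\<exists>g. smooth g \<and> torus_integral c f = torus_integral c g"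
    using assms by blast
  show "h differentiable (at x)" if "\<exists>f. smooth f \<and> h = torus_integral c f" for h x
    using that torus_integral_has_derivative[OF _ assms(2)] differentiableI by blast
  show "\<exists>g. smooth g \<and> partial_deriv v h = torus_integral c g"
    if "\<exists>f. smooth f \<and> h = torus_integral c f" for h v
    using that partial_deriv_torus_integral[OF _ assms(2)] smooth_partial_deriv by metis
qed

lemma weighted_deriv_torus_integral:
  assumes "smooth f" "continuous_on UNIV c"
  shows "weighted_deriv \<beta> \<gamma> (torus_integral c f) x
         = integral torus_cell (\<lambda>t. torus_weighted_deriv (\<lambda>_. 0) \<beta> \<gamma> f (t, x) * c t)"
proof -
  have "multi_deriv (\<lambda>j. axis j 1) \<beta> (torus_integral c f)
        = torus_integral c (multi_deriv (\<lambda>j. (0, axis j 1)) \<beta> f)"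
    by (rule multi_deriv_intertwine[where P = smooth])
       (use assms in \<open>auto simp: smooth_partial_deriv partial_deriv_torus_integral\<close>)
  then show ?thesis
    by (simp add: weighted_deriv_def torus_weighted_deriv_def multi_deriv_zero torus_integral_def
        mult.assoc)
qed

lemma torus_integral_lincomb:
  assumes "smooth f" "smooth g" "continuous_on UNIV c"
  shows "torus_integral c (\<lambda>z. a * f z + b * g z)
         = (\<lambda>x. a * torus_integral c f x + b * torus_integral c g x)"
proof
  fix x
  have "torus_integral c (\<lambda>z. a * f z + b * g z) x
      = integral torus_cell (\<lambda>t. a * (f (t, x) * c t) + b * (g (t, x) * c t))"
    unfolding torus_integral_def by (simp add: algebra_simps)
  also have "\<dots> = a * torus_integral c f x + b * torus_integral c g x"
    unfolding torus_integral_def torus_cell_def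
    using smooth_slice_integrable[OF assms(1,3)] smooth_slice_integrable[OF assms(2,3)]
    by (subst integral_add) (auto intro: integrable_on_mult_right)
  finally show "torus_integral c (\<lambda>z. a * f z + b * g z) x
         = a * torus_integral c f x + b * torus_integral c g x" .
qed

lemma partial_deriv_slice:
  assumes "smooth f"
  shows "partial_deriv v (\<lambda>x. f (t, x)) = (\<lambda>x. partial_deriv (0, v) f (t, x))"
  by (rule partial_deriv_eqI) (rule slice_has_derivative[OF assms])

lemma smooth_slice:
  assumes "smooth f"
  shows "smooth (\<lambda>x. f (t, x))"
proof (rule smooth_coinduct[where P = "\<lambda>h. \<exists>f. smooth f \<and> h = (\<lambda>x. f (t, x))"])
  show "\<exists>g. smooth g \<and> (\<lambda>x. f (t, x)) = (\<lambda>x. g (t, x))"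
    using assms by blast
  show "h differentiable (at x)" if "\<exists>f. smooth f \<and> h = (\<lambda>x. f (t, x))" for h x
    using that slice_has_derivative differentiableI by blast
  show "\<exists>g. smooth g \<and> partial_deriv v h = (\<lambda>x. g (t, x))"
    if "\<exists>f. smooth f \<and> h = (\<lambda>x. f (t, x))" for h v
    using that partial_deriv_slice smooth_partial_deriv by metis
qed

lemma weighted_deriv_slice:
  assumes "smooth f"
  shows "weighted_deriv \<beta> \<gamma> (\<lambda>x. f (t, x)) x = torus_weighted_deriv (\<lambda>_. 0) \<beta> \<gamma> f (t, x)"
proof -
  have "multi_deriv (\<lambda>j. axis j 1) \<beta> (\<lambda>x. f (t, x))
        = (\<lambda>x. multi_deriv (\<lambda>j. (0, axis j 1)) \<beta> f (t, x))"
    by (rule multi_deriv_intertwine[where P = smooth and T = "\<lambda>f x. f (t, x)"])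
       (use assms in \<open>auto simp: smooth_partial_deriv partial_deriv_slice\<close>)
  then show ?thesis
    by (simp add: weighted_deriv_def torus_weighted_deriv_def multi_deriv_zero)
qed

lemma slice_schwartz:
  assumes "f \<in> torus_schwartz"
  shows "(\<lambda>x. f (t, x)) \<in> schwartz"
proof -
  have f: "smooth f" using assms unfolding torus_schwartz_def by simp
  have "bdd_above (range (\<lambda>x. cmod (weighted_deriv \<beta> \<gamma> (\<lambda>x. f (t, x)) x)))" for \<beta> \<gamma>
    unfolding weighted_deriv_slice[OF f]
    using torus_weighted_deriv_le_seminorm[OF assms order_refl] by (auto intro!: bdd_aboveI)
  then show ?thesis
    unfolding schwartz_def using smooth_slice[OF f] by simp
qed

lemma content_torus_cell: "measure lborel (torus_cell :: (real ^ 'm::finite) set) = (2 * pi) ^ CARD('m)"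
proof -
  have "measure lborel (cbox 0 (\<chi> j. 2 * pi) :: (real ^ 'm) set) = (\<Prod>i\<in>(UNIV :: 'm set). 2 * pi)"
    by (subst content_cbox_cart) (auto simp: interval_ne_empty_cart)
  then show ?thesis unfolding torus_cell_def by simp
qed

lemma integral_torus_weighted_deriv_le:
  fixes f :: "(real ^ 'm::finite) \<times> (real ^ 'n::finite) \<Rightarrow> complex"
  assumes f: "f \<in> torus_schwartz" and c: "continuous_on UNIV c" "\<And>t. cmod (c t) \<le> 1"
    and N: "mi_order \<alpha> + mi_order \<beta> + mi_order \<gamma> \<le> N"
  shows "cmod (integral torus_cell (\<lambda>t. torus_weighted_deriv \<alpha> \<beta> \<gamma> f (t, x) * c t))
         \<le> (2 * pi) ^ CARD('m) * torus_seminorm N f"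
proof -
  have sm: "smooth f" using f unfolding torus_schwartz_def by simp
  have "(\<lambda>t. torus_weighted_deriv \<alpha> \<beta> \<gamma> f (t, x) * c t) integrable_on torus_cell"
    unfolding torus_weighted_deriv_def snd_conv torus_cell_def mult.assoc
    by (intro integrable_on_mult_right smooth_slice_integrable[OF _ c(1)] smooth_multi_deriv sm)
  then have "cmod (integral torus_cell (\<lambda>t. torus_weighted_deriv \<alpha> \<beta> \<gamma> f (t, x) * c t))
     \<le> torus_seminorm N f * measure lborel (torus_cell :: (real ^ 'm) set)"
    unfolding torus_cell_def
  proof (intro has_integral_bound[OF _ integrable_integral])
    fix t
    have "cmod (torus_weighted_deriv \<alpha> \<beta> \<gamma> f (t, x)) * cmod (c t) \<le> torus_seminorm N f * 1"
      using torus_weighted_deriv_le_seminorm[OF f N] c(2) torus_seminorm_nonneg[OF f]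
      by (intro mult_mono) auto
    then show "cmod (torus_weighted_deriv \<alpha> \<beta> \<gamma> f (t, x) * c t) \<le> torus_seminorm N f"
      by (simp add: norm_mult)
  qed (use torus_seminorm_nonneg[OF f] in auto)
  then show ?thesis
    by (simp add: content_torus_cell mult.commute)
qed

lemma torus_integral_schwartz:
  assumes f: "f \<in> torus_schwartz" and c: "continuous_on UNIV c" "\<And>t. cmod (c t) \<le> 1"
  shows "torus_integral c f \<in> schwartz"
proof -
  have "bdd_above (range (\<lambda>x. cmod (weighted_deriv \<beta> \<gamma> (torus_integral c f) x)))" for \<beta> \<gamma>
    using integral_torus_weighted_deriv_le[OF assms order_refl] weighted_deriv_torus_integral[OF _ c(1), of f] f
    unfolding torus_schwartz_def by (auto intro!: bdd_aboveI)
  then show ?thesis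
    using smooth_torus_integral[OF _ c(1), of f] f unfolding schwartz_def torus_schwartz_def by simp
qed


section \<open>Functionals commute with torus integrals\<close>

text \<open>The integral and the Riemann sum both split over the cells of the division. On a cell with tag \<open>t\<close>
  they differ by the integral of \<open>h - h t\<close>, a function of size at most \<open>e\<close>.\<close>

lemma riemann_sum_error:
  fixes h :: "'a::euclidean_space \<Rightarrow> 'b::banach"
  assumes h: "h integrable_on cbox a b" and D: "D tagged_division_of cbox a b" and e: "0 \<le> e"
    and osc: "\<And>t K s. (t, K) \<in> D \<Longrightarrow> s \<in> K \<Longrightarrow> norm (h s - h t) \<le> e"
  shows "norm (integral (cbox a b) h - (\<Sum>(t, K)\<in>D. measure lborel K *\<^sub>R h t))
         \<le> e * measure lborel (cbox a b)"
proof -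
  have cell: "norm (integral K h - measure lborel K *\<^sub>R h t) \<le> e * measure lborel K"
    if tK: "(t, K) \<in> D" for t K
  proof -
    obtain u v where K: "K = cbox u v"
      using tagged_division_ofD(4)[OF D tK] by blast
    have "h integrable_on cbox u v"
      using integrable_on_subcbox[OF h] tagged_division_ofD(3)[OF D tK] K by blast
    then have "((\<lambda>s. h s - h t) has_integral (integral K h - measure lborel K *\<^sub>R h t)) (cbox u v)"
      unfolding K by (intro has_integral_diff integrable_integral has_integral_const)
    then show ?thesis
      unfolding K by (rule has_integral_bound[OF e]) (use osc[OF tK] K in auto)
  qed
  have "integral (cbox a b) h - (\<Sum>(t, K)\<in>D. measure lborel K *\<^sub>R h t)
        = (\<Sum>(t, K)\<in>D. integral K h - measure lborel K *\<^sub>R h t)"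
    unfolding integral_combine_tagged_division_topdown[OF h D]
    by (simp add: sum_subtractf case_prod_unfold)
  also have "norm \<dots> \<le> (\<Sum>(t, K)\<in>D. e * measure lborel K)"
    unfolding case_prod_unfold by (rule sum_norm_le) (use cell in force)
  also have "\<dots> = e * measure lborel (cbox a b)"
    using additive_content_tagged_division[OF D] by (simp add: case_prod_unfold sum_distrib_left[symmetric])
  finally show ?thesis .
qed

text \<open>The weight \<open>x\<^sup>\<gamma>\<close> is constant in the torus variables, and each first order torus derivative of
  the weighted function is bounded by a seminorm that does not see \<open>x\<close>. The mean value theorem
  turns this into a Lipschitz constant that is uniform in \<open>x\<close>.\<close>

lemma torus_weighted_deriv_lipschitz:
  fixes f :: "(real ^ 'm::finite) \<times> (real ^ 'n::finite) \<Rightarrow> complex"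
  assumes f: "f \<in> torus_schwartz" and N: "mi_order \<beta> + mi_order \<gamma> < N"
  shows "cmod (torus_weighted_deriv (\<lambda>_. 0) \<beta> \<gamma> f (t, x) - torus_weighted_deriv (\<lambda>_. 0) \<beta> \<gamma> f (s, x))
         \<le> real CARD('m) * torus_seminorm N f * norm (t - s)"
proof -
  define g where "g = multi_deriv (\<lambda>j. (0 :: real ^ 'm, axis j 1)) \<beta> f"
  define W where "W = (\<lambda>t. of_real (mi_power x \<gamma>) * g (t, x))"
  define W' where "W' = (\<lambda>t v. of_real (mi_power x \<gamma>) * partial_deriv (v, 0) g (t, x))"
  have g: "smooth g"
    unfolding g_def using f by (intro smooth_multi_deriv) (simp add: torus_schwartz_def)
  have W: "(W has_derivative W' t) (at t within UNIV)" for t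
  proof -
    have "((\<lambda>t. (t, x)) has_derivative (\<lambda>v. (v, 0))) (at t)"
      by (auto intro!: derivative_eq_intros)
    from has_derivative_compose[OF this smooth_has_derivative[OF g]]
    show ?thesis
      unfolding W_def W'_def by (intro has_derivative_mult_right)
  qed
  have axis: "cmod (W' t (axis i 1)) \<le> torus_seminorm N f" for t i
  proof -
    have "W' t (axis i 1) = torus_weighted_deriv (\<lambda>j. if j = i then 1 else 0) \<beta> \<gamma> f (t, x)"
      unfolding W'_def torus_weighted_deriv_def multi_deriv_single g_def by simp
    then show ?thesis
      using torus_weighted_deriv_le_seminorm[OF f] N by (metis Suc_leI add.assoc mi_order_single plus_1_eq_Suc)
  qed
  have "onorm (W' t) \<le> real CARD('m) * torus_seminorm N f" for t
  proof (rule onorm_le)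
    fix v :: "real ^ 'm"
    have lin: "linear (W' t)"
      using W has_derivative_linear by blast
    have "W' t v = W' t (\<Sum>i\<in>UNIV. v $ i *\<^sub>R axis i 1)"
      by (metis basis_expansion scalar_mult_eq_scaleR)
    also have "\<dots> = (\<Sum>i\<in>UNIV. v $ i *\<^sub>R W' t (axis i 1))"
      by (simp add: linear_sum[OF lin] linear_cmul[OF lin])
    also have "cmod \<dots> \<le> (\<Sum>i\<in>(UNIV :: 'm set). norm v * torus_seminorm N f)"
    proof (rule sum_norm_le)
      fix i :: 'm
      show "norm (v $ i *\<^sub>R W' t (axis i 1)) \<le> norm v * torus_seminorm N f"
        using mult_mono[OF component_le_norm_cart[of v i] axis[of t i]] by simp
    qed
    finally show "cmod (W' t v) \<le> real CARD('m) * torus_seminorm N f * norm v"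
      by (simp add: mult_ac)
  qed
  from differentiable_bound[OF convex_UNIV W this]
  have "cmod (W t - W s) \<le> real CARD('m) * torus_seminorm N f * norm (t - s)"
    by simp
  moreover have "torus_weighted_deriv (\<lambda>_. 0) \<beta> \<gamma> f (t, x) = W t" for t
    unfolding torus_weighted_deriv_def multi_deriv_zero W_def g_def by simp
  ultimately show ?thesis
    by simp
qed

text \<open>The modulus of continuity \<open>d\<close> serves all \<open>x\<close> and all orders up to \<open>N\<close> at once. So the curve
  \<open>t \<mapsto> c(t) f(t, \<cdot>)\<close> is continuous into Schwartz space with the seminorm of index \<open>N\<close>.\<close>

lemma weighted_slices_equicontinuous:
  fixes f :: "(real ^ 'm::finite) \<times> (real ^ 'n::finite) \<Rightarrow> complex"
  assumes f: "f \<in> torus_schwartz" and c: "continuous_on UNIV c" "\<And>t. cmod (c t) \<le> 1"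
    and e: "0 < e"
  obtains d where "0 < d"
    and "\<And>\<beta> \<gamma> s t x. \<lbrakk>mi_order \<beta> + mi_order \<gamma> \<le> N; s \<in> torus_cell; t \<in> torus_cell; dist s t < d\<rbrakk> \<Longrightarrow>
           cmod (torus_weighted_deriv (\<lambda>_. 0) \<beta> \<gamma> f (s, x) * c s
                 - torus_weighted_deriv (\<lambda>_. 0) \<beta> \<gamma> f (t, x) * c t) \<le> e"
proof -
  define L where "L = real CARD('m) * torus_seminorm (Suc N) f"
  define M where "M = torus_seminorm N f"
  have nonneg: "0 \<le> L" "0 \<le> M"
    unfolding L_def M_def using torus_seminorm_nonneg[OF f] by auto
  have half: "(K + 1) * (e / (2 * (K + 1))) = e / 2" if "0 \<le> K" for K
    using that by (simp add: divide_simps)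
  have "uniformly_continuous_on torus_cell c"
    unfolding torus_cell_def
    by (rule compact_uniformly_continuous[OF continuous_on_subset[OF c(1)]]) auto
  moreover have "0 < e / (2 * (M + 1))"
    using e nonneg by simp
  ultimately obtain d1 where d1: "0 < d1"
    "\<And>s t. s \<in> torus_cell \<Longrightarrow> t \<in> torus_cell \<Longrightarrow> dist s t < d1 \<Longrightarrow> dist (c s) (c t) < e / (2 * (M + 1))"
    unfolding uniformly_continuous_on_def by (metis dist_commute)
  define d where "d = min d1 (e / (2 * (L + 1)))"
  show ?thesis
  proof
    show "0 < d"
      unfolding d_def using d1(1) e nonneg by simp
    fix \<beta> \<gamma> :: "'n \<Rightarrow> nat" and s t :: "real ^ 'm" and x :: "real ^ 'n"
    assume N: "mi_order \<beta> + mi_order \<gamma> \<le> N" and st: "s \<in> torus_cell" "t \<in> torus_cell" "dist s t < d"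
    let ?W = "\<lambda>t. torus_weighted_deriv (\<lambda>_. 0) \<beta> \<gamma> f (t, x)"
    have "cmod (?W s - ?W t) \<le> L * norm (s - t)"
      unfolding L_def by (rule torus_weighted_deriv_lipschitz[OF f]) (use N in simp)
    also have "\<dots> \<le> (L + 1) * (e / (2 * (L + 1)))"
      using st(3) nonneg unfolding d_def dist_norm by (intro mult_mono) auto
    also have "\<dots> = e / 2"
      using half[OF nonneg(1)] .
    finally have 1: "cmod (?W s - ?W t) \<le> e / 2" .
    have "cmod (?W t) * cmod (c s - c t) \<le> (M + 1) * (e / (2 * (M + 1)))"
    proof (rule mult_mono)
      have "cmod (?W t) \<le> M"
        unfolding M_def by (rule torus_weighted_deriv_le_seminorm[OF f]) (use N in \<open>simp add: mi_order_zero\<close>)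
      then show "cmod (?W t) \<le> M + 1" by simp
      show "cmod (c s - c t) \<le> e / (2 * (M + 1))"
        using d1(2)[OF st(1,2)] st(3) unfolding d_def dist_norm by simp
    qed (use nonneg in auto)
    then have 2: "cmod (?W t * (c s - c t)) \<le> e / 2"
      unfolding half[OF nonneg(2)] by (simp add: norm_mult)
    have "?W s * c s - ?W t * c t = (?W s - ?W t) * c s + ?W t * (c s - c t)"
      by (simp add: algebra_simps)
    also have "cmod \<dots> \<le> cmod (?W s - ?W t) * cmod (c s) + cmod (?W t * (c s - c t))"
      using norm_triangle_ineq by (metis norm_mult)
    also have "\<dots> \<le> cmod (?W s - ?W t) * 1 + cmod (?W t * (c s - c t))"
      using c(2) by (intro add_right_mono mult_left_mono) auto
    finally show "cmod (?W s * c s - ?W t * c t) \<le> e"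
      using 1 2 by simp
  qed
qed

definition schwartz_linear :: "((real ^ 'n::finite \<Rightarrow> complex) \<Rightarrow> complex) \<Rightarrow> bool" where
  "schwartz_linear w \<longleftrightarrow>
     (\<forall>f\<in>schwartz. \<forall>g\<in>schwartz. \<forall>a b. w (\<lambda>x. a * f x + b * g x) = a * w f + b * w g)"

lemma schwartz_linearD:
  assumes "schwartz_linear w" "f \<in> schwartz" "g \<in> schwartz"
  shows "w (\<lambda>x. a * f x + b * g x) = a * w f + b * w g"
  using assms unfolding schwartz_linear_def by blast

lemma schwartz_linear_sum:
  assumes "schwartz_linear w" "finite I" "\<And>i. i \<in> I \<Longrightarrow> F i \<in> schwartz"
  shows "w (\<lambda>x. \<Sum>i\<in>I. a i * F i x) = (\<Sum>i\<in>I. a i * w (F i))"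
  using assms(2,3)
proof (induction I rule: finite_induct)
  case empty
  show ?case
    using schwartz_linearD[OF assms(1) schwartz_zero schwartz_zero, of 0 0] by simp
next
  case (insert j I)
  then have "F j \<in> schwartz" "(\<lambda>x. \<Sum>i\<in>I. a i * F i x) \<in> schwartz"
    using schwartz_sum[of I F a] by auto
  with insert show ?case
    using schwartz_linearD[OF assms(1), of "F j" "\<lambda>x. \<Sum>i\<in>I. a i * F i x" "a j" 1]
    by simp
qed

lemma tempered_distribution_schwartz_linear:
  assumes "w \<in> tempered_distributions"
  shows "schwartz_linear w"
  unfolding schwartz_linear_def
proof (intro ballI allI)
  fix f g :: "real ^ 'a \<Rightarrow> complex" and a b
  assume fg: "f \<in> schwartz" "g \<in> schwartz"
  have add: "\<forall>f\<in>schwartz. \<forall>g\<in>schwartz. w (\<lambda>x. f x + g x) = w f + w g"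
    and scale: "\<forall>c. \<forall>f\<in>schwartz. w (\<lambda>x. c * f x) = c * w f"
    using assms unfolding tempered_distributions_def topological_dual_def by auto
  have "(\<lambda>x. c * f x) \<in> schwartz" if "f \<in> schwartz" for c and f :: "real ^ 'a \<Rightarrow> complex"
    using schwartz_lincomb[OF that that, of c 0] by simp
  then show "w (\<lambda>x. a * f x + b * g x) = a * w f + b * w g"
    using add scale fg by simp
qed

text \<open>A functional that is bounded by one Schwartz seminorm may be pulled into the integral. A Riemann
  sum of \<open>t \<mapsto> c(t) f(t, \<cdot>)\<close> is a finite linear combination of slices, on which linearity gives the
  claim exactly. By equicontinuity the same fine division makes this sum close to the integral in the
  seminorm and makes its image under \<open>w\<close> close to the integral of the images.\<close>

lemma has_integral_functional_slices:
  fixes f :: "(real ^ 'm::finite) \<times> (real ^ 'n::finite) \<Rightarrow> complex"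
  assumes f: "f \<in> torus_schwartz" and c: "continuous_on UNIV c" "\<And>t. cmod (c t) \<le> 1"
    and lin: "schwartz_linear w" and C: "0 \<le> C"
    and bound: "\<And>g. g \<in> schwartz \<Longrightarrow> cmod (w g) \<le> C * schwartz_seminorm N g"
  shows "((\<lambda>t. w (\<lambda>x. f (t, x)) * c t) has_integral w (torus_integral c f)) torus_cell"
proof -
  define h where "h = (\<lambda>t. w (\<lambda>x. f (t, x)) * c t)"
  define B where "B = C * real (schwartz_order_count TYPE('n) N)"
  define V where "V = measure lborel (torus_cell :: (real ^ 'm) set)"
  have nonneg: "0 \<le> B" "0 \<le> V"
    unfolding B_def V_def using C by auto
  have sm: "smooth f"
    using f by (simp add: torus_schwartz_def)
  note slice = slice_schwartz[OF f]
  have w_le: "cmod (w g) \<le> B * e"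
    if "g \<in> schwartz" "\<And>\<beta> \<gamma> x. mi_order \<beta> + mi_order \<gamma> \<le> N \<Longrightarrow> cmod (weighted_deriv \<beta> \<gamma> g x) \<le> e" for g e
  proof -
    have "cmod (w g) \<le> C * schwartz_seminorm N g"
      by (rule bound[OF that(1)])
    also have "\<dots> \<le> C * (real (schwartz_order_count TYPE('n) N) * e)"
      using C by (intro mult_left_mono schwartz_seminorm_le that(2))
    finally show ?thesis
      by (simp add: B_def)
  qed
  \<comment> \<open>One \<open>d\<close> controls both the scalar integrand \<open>h\<close> and the weighted derivatives of the slices.\<close>
  have modulus: "\<exists>d>0. (\<forall>s\<in>torus_cell. \<forall>t\<in>torus_cell. dist s t < d \<longrightarrow> cmod (h s - h t) \<le> B * e)
      \<and> (\<forall>\<beta> \<gamma> x. \<forall>s\<in>torus_cell. \<forall>t\<in>torus_cell. mi_order \<beta> + mi_order \<gamma> \<le> N \<longrightarrow> dist s t < d \<longrightarrow>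
           cmod (torus_weighted_deriv (\<lambda>_. 0) \<beta> \<gamma> f (s, x) * c s
                 - torus_weighted_deriv (\<lambda>_. 0) \<beta> \<gamma> f (t, x) * c t) \<le> e)" if e: "0 < e" for e
  proof -
    obtain d where d: "0 < d"
      "\<And>\<beta> \<gamma> s t x. \<lbrakk>mi_order \<beta> + mi_order \<gamma> \<le> N; s \<in> torus_cell; t \<in> torus_cell; dist s t < d\<rbrakk> \<Longrightarrow>
           cmod (torus_weighted_deriv (\<lambda>_. 0) \<beta> \<gamma> f (s, x) * c s
                 - torus_weighted_deriv (\<lambda>_. 0) \<beta> \<gamma> f (t, x) * c t) \<le> e"
      using weighted_slices_equicontinuous[OF f c e] by blast
    have "cmod (h s - h t) \<le> B * e" if st: "s \<in> torus_cell" "t \<in> torus_cell" "dist s t < d" for s t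
    proof -
      have "h s - h t = w (\<lambda>x. c s * f (s, x) + (- c t) * f (t, x))"
        unfolding h_def schwartz_linearD[OF lin slice slice] by simp
      also have "cmod \<dots> \<le> B * e"
      proof (rule w_le)
        show "(\<lambda>x. c s * f (s, x) + (- c t) * f (t, x)) \<in> schwartz"
          by (rule schwartz_lincomb[OF slice slice])
        fix \<beta> \<gamma> :: "'n \<Rightarrow> nat" and x
        assume "mi_order \<beta> + mi_order \<gamma> \<le> N"
        from d(2)[OF this st]
        show "cmod (weighted_deriv \<beta> \<gamma> (\<lambda>x. c s * f (s, x) + (- c t) * f (t, x)) x) \<le> e"
          unfolding weighted_deriv_lincomb[OF smooth_slice[OF sm] smooth_slice[OF sm]]
            weighted_deriv_slice[OF sm] by (simp add: mult.commute)
      qed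
      finally show ?thesis .
    qed
    with d show ?thesis by blast
  qed
  have integrable: "h integrable_on torus_cell"
    unfolding torus_cell_def
  proof (rule integrable_continuous, unfold continuous_on_iff, intro ballI allI impI)
    fix t :: "real ^ 'm" and e :: real
    assume t: "t \<in> cbox 0 (\<chi> j. 2 * pi)" and e: "0 < e"
    have "0 < e / (B + 1)"
      using e nonneg by simp
    from modulus[OF this] obtain d where d: "0 < d"
      "\<And>s t. s \<in> torus_cell \<Longrightarrow> t \<in> torus_cell \<Longrightarrow> dist s t < d \<Longrightarrow> cmod (h s - h t) \<le> B * (e / (B + 1))"
      by blast
    have "B * (e / (B + 1)) < e"
      using e nonneg by (simp add: field_simps)
    with d t show "\<exists>d>0. \<forall>s\<in>cbox 0 (\<chi> j. 2 * pi). dist s t < d \<longrightarrow> dist (h s) (h t) < e"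
      unfolding dist_norm torus_cell_def by (meson order_le_less_trans)
  qed
  have "cmod (integral torus_cell h - w (torus_integral c f)) \<le> 2 * B * V * e" if e: "0 < e" for e
  proof -
    from modulus[OF e] obtain d where d: "0 < d"
      and dh: "\<And>s t. s \<in> torus_cell \<Longrightarrow> t \<in> torus_cell \<Longrightarrow> dist s t < d \<Longrightarrow> cmod (h s - h t) \<le> B * e"
      and dW: "\<And>\<beta> \<gamma> s t x. s \<in> torus_cell \<Longrightarrow> t \<in> torus_cell \<Longrightarrow> mi_order \<beta> + mi_order \<gamma> \<le> N
           \<Longrightarrow> dist s t < d \<Longrightarrow> cmod (torus_weighted_deriv (\<lambda>_. 0) \<beta> \<gamma> f (s, x) * c s
                 - torus_weighted_deriv (\<lambda>_. 0) \<beta> \<gamma> f (t, x) * c t) \<le> e"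
      by blast
    obtain D where D: "D tagged_division_of (torus_cell :: (real ^ 'm) set)" "(\<lambda>t. ball t d) fine D"
      unfolding torus_cell_def using fine_division_exists[OF gauge_ball[OF d]] .
    have near: "s \<in> torus_cell \<and> t \<in> torus_cell \<and> dist s t < d" if "(t, K) \<in> D" "s \<in> K" for s t K
      using that tagged_division_ofD(2,3)[OF D(1) that(1)] fineD[OF D(2) that(1)]
      by (auto simp: dist_commute)
    have fin: "finite D"
      using D(1) by blast
    \<comment> \<open>The Riemann sum of the curve of slices, as a Schwartz function of \<open>x\<close>.\<close>
    define R where "R = (\<lambda>x. \<Sum>p\<in>D. (of_real (measure lborel (snd p)) * c (fst p)) * f (fst p, x))"
    have R: "R \<in> schwartz"
      unfolding R_def by (rule schwartz_sum[OF fin slice])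
    have wR: "w R = (\<Sum>(t, K)\<in>D. measure lborel K *\<^sub>R h t)"
      unfolding R_def schwartz_linear_sum[OF lin fin slice] h_def
      by (simp add: case_prod_unfold scaleR_conv_of_real mult_ac)
    have I: "torus_integral c f \<in> schwartz"
      by (rule torus_integral_schwartz[OF f c])
    have "cmod (integral torus_cell h - w R) \<le> B * e * V"
      unfolding wR V_def torus_cell_def
      by (rule riemann_sum_error)
         (use integrable D(1) near dh nonneg e in \<open>auto simp: torus_cell_def\<close>)
    moreover have "cmod (w R - w (torus_integral c f)) \<le> B * (e * V)"
    proof -
      have "w R - w (torus_integral c f) = w (\<lambda>x. 1 * R x + (-1) * torus_integral c f x)"
        unfolding schwartz_linearD[OF lin R I] by simp
      also have "cmod \<dots> \<le> B * (e * V)"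
      proof (rule w_le)
        show "(\<lambda>x. 1 * R x + (-1) * torus_integral c f x) \<in> schwartz"
          by (rule schwartz_lincomb[OF R I])
        fix \<beta> \<gamma> :: "'n \<Rightarrow> nat" and x
        assume N: "mi_order \<beta> + mi_order \<gamma> \<le> N"
        define W where "W = (\<lambda>t. torus_weighted_deriv (\<lambda>_. 0) \<beta> \<gamma> f (t, x) * c t)"
        have "W integrable_on torus_cell"
          unfolding W_def torus_weighted_deriv_def snd_conv torus_cell_def mult.assoc
          by (intro integrable_on_mult_right smooth_slice_integrable[OF _ c(1)] smooth_multi_deriv sm)
        then have "cmod (integral torus_cell W - (\<Sum>(t, K)\<in>D. measure lborel K *\<^sub>R W t)) \<le> e * V"
          unfolding V_def torus_cell_def
          by (rule riemann_sum_error)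
             (use D(1) near dW N e in \<open>auto simp: torus_cell_def W_def\<close>)
        moreover have "weighted_deriv \<beta> \<gamma> R x = (\<Sum>(t, K)\<in>D. measure lborel K *\<^sub>R W t)"
          unfolding R_def weighted_deriv_sum[OF fin slice] weighted_deriv_slice[OF sm] W_def
          by (simp add: case_prod_unfold scaleR_conv_of_real mult_ac)
        moreover have "weighted_deriv \<beta> \<gamma> (torus_integral c f) x = integral torus_cell W"
          unfolding W_def by (rule weighted_deriv_torus_integral[OF sm c(1)])
        moreover have "smooth R" "smooth (torus_integral c f)"
          using R I by (auto simp: schwartz_def)
        ultimately show "cmod (weighted_deriv \<beta> \<gamma> (\<lambda>x. 1 * R x + (-1) * torus_integral c f x) x) \<le> e * V"
          by (subst weighted_deriv_lincomb) (auto simp: norm_minus_commute)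
      qed
      finally show ?thesis .
    qed
    ultimately have "cmod (integral torus_cell h - w R) + cmod (w R - w (torus_integral c f)) \<le> 2 * B * V * e"
      by (simp add: mult_ac)
    then show ?thesis
      using norm_triangle_ineq[of "integral torus_cell h - w R" "w R - w (torus_integral c f)"] by simp
  qed
  then have small: "cmod (integral torus_cell h - w (torus_integral c f)) \<le> e" if "0 < e" for e
  proof -
    have "K * (e / (K + 1)) \<le> e" if "0 \<le> K" for K
      using that \<open>0 < e\<close> by (simp add: field_simps)
    from this[of "2 * B * V"] have "2 * B * V * (e / (2 * B * V + 1)) \<le> e"
      using nonneg by simp
    moreover have "0 < e / (2 * B * V + 1)"
      using that nonneg by (intro divide_pos_pos add_nonneg_pos) auto
    ultimately show ?thesis
      using \<open>\<And>e. 0 < e \<Longrightarrow> cmod (integral torus_cell h - w (torus_integral c f)) \<le> 2 * B * V * e\<close>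
      by (meson order_trans)
  qed
  have "integral torus_cell h = w (torus_integral c f)"
    using field_le_epsilon[of "cmod (integral torus_cell h - w (torus_integral c f))" 0] small by simp
  then show ?thesis
    using integrable_integral[OF integrable] unfolding h_def by simp
qed


section \<open>Integration by parts on the torus\<close>

text \<open>The translated cell sticks out of the cell by a slab beyond \<open>2\<pi>\<close> in direction \<open>i\<close>; periodicity
  moves that slab back to the gap that the translation left at \<open>0\<close>.\<close>

lemma integral_torus_cell_shift:
  fixes h :: "real ^ 'm::finite \<Rightarrow> complex"
  assumes h: "continuous_on UNIV h" and per: "\<And>t. h (t + axis i (2 * pi)) = h t"
    and s: "0 \<le> s" "s \<le> 2 * pi"
  shows "integral torus_cell (\<lambda>t. h (t + axis i s)) = integral torus_cell h"
proof -
  define b :: "real ^ 'm" where "b = (\<chi> j. 2 * pi)"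
  define b' :: "real ^ 'm" where "b' = (\<chi> j. if j = i then s else 2 * pi)"
  have int: "h integrable_on cbox u v" for u v
    by (rule integrable_continuous) (rule continuous_on_subset[OF h subset_UNIV])
  have Basis: "(axis i 1 :: real ^ 'm) \<in> Basis"
    by (simp add: axis_in_Basis_iff)
  have ax: "(axis i a :: real ^ 'm) $ j = (if j = i then a else 0)" for a j
    by (simp add: axis_def)
  have box: "x \<in> cbox u v \<longleftrightarrow> u $ i \<le> x $ i \<and> x $ i \<le> v $ i
      \<and> (\<forall>j. j \<noteq> i \<longrightarrow> u $ j \<le> x $ j \<and> x $ j \<le> v $ j)" for x u v :: "real ^ 'm"
    unfolding mem_box_cart by metis
  have shift: "integral (cbox u v) (\<lambda>t. h (t + e)) = integral (cbox (u + e) (v + e)) h" for u v e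
    using integral_shift_cbox[of "u + e" e "v + e" h] by simp
  have "integral torus_cell (\<lambda>t. h (t + axis i s)) = integral (cbox (axis i s) (b + axis i s)) h"
    unfolding torus_cell_def b_def[symmetric] shift by simp
  also have "\<dots> = integral (cbox (axis i s) (b + axis i s) \<inter> {x. x \<bullet> axis i 1 \<le> 2 * pi}) h
      + integral (cbox (axis i s) (b + axis i s) \<inter> {x. x \<bullet> axis i 1 \<ge> 2 * pi}) h"
    by (rule integral_split[OF int Basis])
  also have "cbox (axis i s) (b + axis i s) \<inter> {x. x \<bullet> axis i 1 \<le> 2 * pi} = cbox (axis i s) b"
    using s by (auto simp: box ax inner_axis b_def)
  also have "cbox (axis i s) (b + axis i s) \<inter> {x. x \<bullet> axis i 1 \<ge> 2 * pi}
      = cbox (0 + axis i (2 * pi)) (b' + axis i (2 * pi))"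
    using s by (auto simp: box ax inner_axis b_def b'_def)
  also have "integral (cbox (0 + axis i (2 * pi)) (b' + axis i (2 * pi))) h = integral (cbox 0 b') h"
    unfolding shift[symmetric] per ..
  also have "cbox 0 b' = cbox 0 b \<inter> {x. x \<bullet> axis i 1 \<le> s}"
    using s by (auto simp: box ax inner_axis b_def b'_def)
  also have "cbox (axis i s) b = cbox 0 b \<inter> {x. x \<bullet> axis i 1 \<ge> s}"
    using s by (auto simp: box ax inner_axis b_def)
  also have "integral (cbox 0 b \<inter> {x. x \<bullet> axis i 1 \<ge> s}) h + integral (cbox 0 b \<inter> {x. x \<bullet> axis i 1 \<le> s}) h
      = integral (cbox 0 b) h"
    using integral_split[OF int Basis] by (simp add: add.commute)
  finally show ?thesis
    unfolding torus_cell_def b_def .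
qed

definition torus_char :: "int ^ 'm::finite \<Rightarrow> real ^ 'm \<Rightarrow> complex" where
  "torus_char k t = exp (\<i> * of_real (real_vec k \<bullet> t))"

lemma norm_torus_char: "cmod (torus_char k t) \<le> 1"
  unfolding torus_char_def by simp

lemma continuous_on_torus_char:
  assumes "continuous_on A g"
  shows "continuous_on A (\<lambda>z. torus_char k (g z))"
  unfolding torus_char_def by (intro continuous_intros assms)

lemma continuous_torus_char: "continuous_on A (torus_char k)"
  using continuous_on_torus_char[OF continuous_on_id] by simp

lemma torus_char_shift:
  "torus_char k (t + axis i s) = torus_char k t * exp (\<i> * of_real (real_of_int (k $ i) * s))"
  unfolding torus_char_def
  by (simp add: inner_add_right inner_axis real_vec_def distrib_left exp_add)

lemma torus_char_periodic: "torus_char k (t + axis i (2 * pi)) = torus_char k t"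
proof -
  have "exp (\<i> * of_real (real_of_int (k $ i) * (2 * pi))) = 1"
    using exp_integer_2pi[of "of_int (k $ i)"] by (simp add: mult_ac)
  then show ?thesis
    unfolding torus_char_shift by simp
qed

lemma real_vec_uminus: "real_vec (- k) = - real_vec k"
  by (simp add: real_vec_def vec_eq_iff)

lemma fourier_coeff_eq:
  fixes f :: "(real ^ 'm::finite) \<times> (real ^ 'n::finite) \<Rightarrow> complex"
  shows "fourier_coeff f (- k) = (\<lambda>x. 1 / of_real ((2 * pi) ^ CARD('m)) * torus_integral (torus_char k) f x)"
  unfolding fourier_coeff_def torus_integral_def torus_char_def real_vec_uminus by simp

lemma torus_periodic_partial_deriv:
  fixes f :: "(real ^ 'm::finite) \<times> (real ^ 'n::finite) \<Rightarrow> complex"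
  assumes f: "smooth f" "torus_periodic f"
  shows "torus_periodic (partial_deriv v f)"
  unfolding torus_periodic_def
proof (intro allI)
  fix t :: "real ^ 'm" and x :: "real ^ 'n" and j
  let ?p = "(axis j (2 * pi), 0) :: (real ^ 'm) \<times> (real ^ 'n)"
  have "((\<lambda>z. f (z + ?p)) has_derivative (\<lambda>v. partial_deriv v f (z + ?p))) (at z)" for z
    by (rule has_derivative_compose[OF _ smooth_has_derivative[OF f(1)], where f' = "\<lambda>v. v"])
       (auto intro!: derivative_eq_intros)
  then have "partial_deriv v (\<lambda>z. f (z + ?p)) = (\<lambda>z. partial_deriv v f (z + ?p))"
    by (rule partial_deriv_eqI)
  moreover have "(\<lambda>z. f (z + ?p)) = f"
    using f(2) by (auto simp: torus_periodic_def)
  ultimately have "partial_deriv v f (t, x) = partial_deriv v f ((t, x) + ?p)"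
    by metis
  then show "partial_deriv v f (t + axis j (2 * pi), x) = partial_deriv v f (t, x)"
    by simp
qed

text \<open>Translating the argument of \<open>f\<close> by \<open>s\<close> in direction \<open>i\<close> multiplies the integral by
  \<open>exp(- i k\<^sub>i s)\<close>, because the cell may be translated along. Differentiating both sides at \<open>s = 0\<close>
  yields the formula; boundary terms never arise.\<close>

lemma torus_integral_by_parts:
  fixes f :: "(real ^ 'm::finite) \<times> (real ^ 'n::finite) \<Rightarrow> complex"
  assumes f: "smooth f" "torus_periodic f"
  shows "torus_integral (torus_char k) (partial_deriv (axis i 1, 0) f) x
         = - (\<i> * of_int (k $ i)) * torus_integral (torus_char k) f x"
proof -
  define \<phi> where "\<phi> = (\<lambda>s. integral torus_cell (\<lambda>t. f (t + s *\<^sub>R axis i 1, x) * torus_char k t))"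
  define J where "J = torus_integral (torus_char k) f x"
  define D where "D = (\<lambda>s t. partial_deriv (axis i 1, 0) f (t + s *\<^sub>R axis i 1, x) * torus_char k t)"
  have axis: "s *\<^sub>R (axis i 1 :: real ^ 'm) = axis i s" for s
    by (simp add: vec_eq_iff axis_def)
  have \<phi>: "\<phi> s = exp (- (\<i> * of_real (real_of_int (k $ i) * s))) * J" if s: "s \<in> {0..2 * pi}" for s
  proof -
    let ?E = "exp (- (\<i> * of_real (real_of_int (k $ i) * s)))"
    have "f (t + s *\<^sub>R axis i 1, x) * torus_char k t
        = ?E * (f (t + s *\<^sub>R axis i 1, x) * torus_char k (t + s *\<^sub>R axis i 1))" for t
      unfolding axis torus_char_shift by (simp add: exp_minus)
    then have "\<phi> s = integral torus_cell (\<lambda>t. ?E * (f (t + s *\<^sub>R axis i 1, x) * torus_char k (t + s *\<^sub>R axis i 1)))"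
      unfolding \<phi>_def by (simp only:)
    also have "\<dots> = ?E * integral torus_cell (\<lambda>t. f (t + s *\<^sub>R axis i 1, x) * torus_char k (t + s *\<^sub>R axis i 1))"
      by (rule integral_mult_right)
    also have "integral torus_cell (\<lambda>t. f (t + s *\<^sub>R axis i 1, x) * torus_char k (t + s *\<^sub>R axis i 1)) = J"
      unfolding J_def torus_integral_def axis
    proof (rule integral_torus_cell_shift[where h = "\<lambda>t. f (t, x) * torus_char k t"])
      show "continuous_on UNIV (\<lambda>t. f (t, x) * torus_char k t)"
        by (rule continuous_on_mult[OF continuous_on_smooth[OF f(1)] continuous_torus_char])
           (intro continuous_intros)
    qed (use f(2) s in \<open>auto simp: torus_char_periodic torus_periodic_def\<close>)
    finally show ?thesis .
  qed
  have cont: "continuous_on ({0..2 * pi} \<times> cbox u v) (\<lambda>(s, t). D s t)" for u v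
    unfolding D_def case_prod_unfold
    by (rule continuous_on_mult[OF continuous_on_smooth[OF smooth_partial_deriv[OF f(1)]]
          continuous_on_torus_char]) (intro continuous_intros)+
  have 1: "(\<phi> has_vector_derivative integral torus_cell (D 0)) (at 0 within {0..2 * pi})"
    unfolding \<phi>_def torus_cell_def
  proof (rule leibniz_rule_vector_derivative[OF _ _ cont])
    fix s :: real and t :: "real ^ 'm"
    have "((\<lambda>s. (t + s *\<^sub>R axis i 1, x)) has_derivative (\<lambda>v. v *\<^sub>R (axis i 1, 0))) (at s within {0..2 * pi})"
      by (auto intro!: derivative_eq_intros)
    from has_derivative_compose[OF this smooth_has_derivative[OF f(1)]]
    have "((\<lambda>s. f (t + s *\<^sub>R axis i 1, x)) has_derivative
           (\<lambda>v. v *\<^sub>R partial_deriv (axis i 1, 0) f (t + s *\<^sub>R axis i 1, x))) (at s within {0..2 * pi})"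
      using linear_cmul[OF has_derivative_linear[OF smooth_has_derivative[OF f(1)]], of _ "(axis i 1, 0)"]
      by simp
    then have "((\<lambda>s. f (t + s *\<^sub>R axis i 1, x)) has_vector_derivative
           partial_deriv (axis i 1, 0) f (t + s *\<^sub>R axis i 1, x)) (at s within {0..2 * pi})"
      unfolding has_vector_derivative_def .
    then show "((\<lambda>s. f (t + s *\<^sub>R axis i 1, x) * torus_char k t) has_vector_derivative D s t) (at s within {0..2 * pi})"
      unfolding D_def by (rule has_vector_derivative_mult_left)
  next
    fix s :: real
    show "(\<lambda>t. f (t + s *\<^sub>R axis i 1, x) * torus_char k t) integrable_on cbox 0 (\<chi> j. 2 * pi)"
      by (rule integrable_continuous,
          rule continuous_on_mult[OF continuous_on_smooth[OF f(1)] continuous_torus_char])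
         (intro continuous_intros)
  qed auto
  have "((\<lambda>s. exp (- (\<i> * of_real (real_of_int (k $ i) * s))) * J)
          has_vector_derivative (- (\<i> * of_int (k $ i)) * J)) (at 0 within {0..2 * pi})"
    by (auto intro!: derivative_eq_intros has_vector_derivative_real_field simp: field_simps)
  then have 2: "(\<phi> has_vector_derivative (- (\<i> * of_int (k $ i)) * J)) (at 0 within {0..2 * pi})"
    by (rule has_vector_derivative_transform[rotated 2]) (use \<phi> in auto)
  have "integral torus_cell (D 0) = - (\<i> * of_int (k $ i)) * J"
    by (rule vector_derivative_unique_within_closed_interval[OF _ _ 1[unfolded interval_cbox]
          2[unfolded interval_cbox]]) auto
  then show ?thesis
    unfolding torus_integral_def D_def J_def by simp
qed

lemma torus_integral_iterated_by_parts:
  fixes f :: "(real ^ 'm::finite) \<times> (real ^ 'n::finite) \<Rightarrow> complex"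
  assumes f: "smooth f" "torus_periodic f"
  shows "torus_integral (torus_char k) ((partial_deriv (axis i 1, 0) ^^ r) f) x
         = (- (\<i> * of_int (k $ i))) ^ r * torus_integral (torus_char k) f x"
proof (induction r)
  case (Suc r)
  have "smooth ((partial_deriv (axis i 1, 0) ^^ r) f) \<and> torus_periodic ((partial_deriv (axis i 1, 0) ^^ r) f)"
    using f by (induction r) (auto simp: smooth_partial_deriv torus_periodic_partial_deriv)
  then show ?case
    using Suc by (simp add: torus_integral_by_parts)
qed simp

text \<open>Integrating by parts \<open>r\<close> times turns \<open>k\<^sub>i\<^sup>r\<close> into an \<open>r\<close>-fold torus derivative of \<open>f\<close>. It falls on
  the \<open>x\<close>-derivatives already taken, which is the order in which the seminorms differentiate.\<close>

lemma power_weighted_deriv_torus_integral_le: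
  fixes f :: "(real ^ 'm::finite) \<times> (real ^ 'n::finite) \<Rightarrow> complex"
  assumes f: "f \<in> torus_schwartz" and N: "r + mi_order \<beta> + mi_order \<gamma> \<le> N"
  shows "\<bar>real_of_int (k $ i)\<bar> ^ r * cmod (weighted_deriv \<beta> \<gamma> (torus_integral (torus_char k) f) x)
         \<le> (2 * pi) ^ CARD('m) * torus_seminorm N f"
proof -
  define g where "g = multi_deriv (\<lambda>j. (0 :: real ^ 'm, axis j 1)) \<beta> f"
  have sm: "smooth f" "torus_periodic f"
    using f by (auto simp: torus_schwartz_def)
  have g: "smooth g \<and> torus_periodic g"
    unfolding g_def using sm
    by (intro multi_deriv_invariant[where P = "\<lambda>g. smooth g \<and> torus_periodic g"])
       (auto simp: smooth_partial_deriv torus_periodic_partial_deriv)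
  let ?\<alpha> = "\<lambda>j. if j = i then r else 0"
  have "integral torus_cell (\<lambda>t. torus_weighted_deriv ?\<alpha> \<beta> \<gamma> f (t, x) * torus_char k t)
      = of_real (mi_power x \<gamma>) * torus_integral (torus_char k) ((partial_deriv (axis i 1, 0) ^^ r) g) x"
    unfolding torus_weighted_deriv_def multi_deriv_single g_def torus_integral_def by (simp add: mult.assoc)
  also have "\<dots> = (- (\<i> * of_int (k $ i))) ^ r * (of_real (mi_power x \<gamma>) * torus_integral (torus_char k) g x)"
    using g by (simp add: torus_integral_iterated_by_parts)
  also have "of_real (mi_power x \<gamma>) * torus_integral (torus_char k) g x
      = weighted_deriv \<beta> \<gamma> (torus_integral (torus_char k) f) x"
    unfolding weighted_deriv_torus_integral[OF sm(1) continuous_torus_char] torus_weighted_deriv_def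
      multi_deriv_zero g_def torus_integral_def by (simp add: mult.assoc)
  finally have "\<bar>real_of_int (k $ i)\<bar> ^ r * cmod (weighted_deriv \<beta> \<gamma> (torus_integral (torus_char k) f) x)
      = cmod (integral torus_cell (\<lambda>t. torus_weighted_deriv ?\<alpha> \<beta> \<gamma> f (t, x) * torus_char k t))"
    by (simp add: norm_mult norm_power)
  also have "\<dots> \<le> (2 * pi) ^ CARD('m) * torus_seminorm N f"
    by (rule integral_torus_weighted_deriv_le[OF f continuous_torus_char norm_torus_char])
       (use N in \<open>simp add: mi_order_single\<close>)
  finally show ?thesis .
qed

text \<open>Both sums, with the summand \<open>1\<close> included, are comparable to their largest term.\<close>

lemma power_one_plus_sum_le:
  fixes a :: "'i::finite \<Rightarrow> real"
  assumes "\<And>i. 0 \<le> a i"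
  shows "(1 + (\<Sum>i\<in>UNIV. a i)) ^ r \<le> real (Suc CARD('i)) ^ r * (1 + (\<Sum>i\<in>UNIV. a i ^ r))"
proof -
  define M where "M = Max (insert 1 (range a))"
  have M: "1 \<le> M" "\<And>i. a i \<le> M"
    unfolding M_def by (rule Max_ge; simp)+
  have "M \<in> insert 1 (range a)"
    unfolding M_def by (rule Max_in) auto
  then have "M ^ r \<le> 1 + (\<Sum>i\<in>UNIV. a i ^ r)"
  proof
    assume "M = 1"
    then show ?thesis using assms by (simp add: sum_nonneg)
  next
    assume "M \<in> range a"
    then obtain i where "M = a i" by blast
    moreover have "a i ^ r \<le> (\<Sum>i\<in>UNIV. a i ^ r)"
      using assms by (intro member_le_sum) auto
    ultimately show ?thesis by simp
  qed
  have "1 + (\<Sum>i\<in>UNIV. a i) \<le> M + (\<Sum>i\<in>(UNIV :: 'i set). M)"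
    using M by (intro add_mono sum_mono) auto
  also have "\<dots> = real (Suc CARD('i)) * M"
    by (simp add: algebra_simps)
  finally have "(1 + (\<Sum>i\<in>UNIV. a i)) ^ r \<le> (real (Suc CARD('i)) * M) ^ r"
    using assms by (intro power_mono) (auto simp: sum_nonneg add_nonneg_nonneg)
  also have "\<dots> \<le> real (Suc CARD('i)) ^ r * (1 + (\<Sum>i\<in>UNIV. a i ^ r))"
    unfolding power_mult_distrib using \<open>M ^ r \<le> _\<close> by (intro mult_left_mono) auto
  finally show ?thesis .
qed

lemma norm_real_vec_sq: "(norm (real_vec k))\<^sup>2 = (\<Sum>i\<in>UNIV. (real_of_int (k $ i))\<^sup>2)"
  unfolding power2_norm_eq_inner inner_vec_def real_vec_def by (simp add: power2_eq_square)

text \<open>Rapid decay in \<open>k\<close>, with a constant that depends on neither \<open>k\<close> nor \<open>f\<close>: the power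
  \<open>(1 + |k|\<^sup>2)\<^sup>r\<close> is dominated by \<open>1\<close> and the pure powers \<open>(k\<^sub>i\<^sup>2)\<^sup>r\<close>, so that at most \<open>2r\<close> torus derivatives of \<open>f\<close> in a single direction are spent.\<close>

lemma schwartz_seminorm_torus_integral_decay:
  fixes f :: "(real ^ 'm::finite) \<times> (real ^ 'n::finite) \<Rightarrow> complex"
  assumes f: "f \<in> torus_schwartz"
  shows "(1 + (norm (real_vec k))\<^sup>2) ^ r * schwartz_seminorm N (torus_integral (torus_char k) f)
     \<le> real (schwartz_order_count TYPE('n) N) * (real (Suc CARD('m)) ^ Suc r * (2 * pi) ^ CARD('m))
        * torus_seminorm (2 * r + N) f"
proof -
  define Q where "Q = (1 + (norm (real_vec k))\<^sup>2) ^ r"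
  define S where "S = (2 * pi) ^ CARD('m) * torus_seminorm (2 * r + N) f"
  have Q: "0 < Q"
    unfolding Q_def by (intro zero_less_power add_pos_nonneg) auto
  have "schwartz_seminorm N (torus_integral (torus_char k) f)
        \<le> real (schwartz_order_count TYPE('n) N) * (real (Suc CARD('m)) ^ Suc r * S / Q)"
  proof (rule schwartz_seminorm_le)
    fix \<beta> \<gamma> :: "'n \<Rightarrow> nat" and x
    assume N: "mi_order \<beta> + mi_order \<gamma> \<le> N"
    define A where "A = cmod (weighted_deriv \<beta> \<gamma> (torus_integral (torus_char k) f) x)"
    have one: "A \<le> S" and pow: "(real_of_int (k $ i) ^ 2) ^ r * A \<le> S" for i
      using power_weighted_deriv_torus_integral_le[OF f, of 0 \<beta> \<gamma> "2 * r + N" k i x]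
        power_weighted_deriv_torus_integral_le[OF f, of "2 * r" \<beta> \<gamma> "2 * r + N" k i x] N
      unfolding A_def S_def by (auto simp: power_mult)
    have "Q \<le> real (Suc CARD('m)) ^ r * (1 + (\<Sum>i\<in>UNIV. (real_of_int (k $ i) ^ 2) ^ r))"
      unfolding Q_def norm_real_vec_sq by (rule power_one_plus_sum_le) simp
    then have "Q * A \<le> real (Suc CARD('m)) ^ r * (1 + (\<Sum>i\<in>UNIV. (real_of_int (k $ i) ^ 2) ^ r)) * A"
      by (rule mult_right_mono) (simp add: A_def)
    also have "\<dots> = real (Suc CARD('m)) ^ r * (A + (\<Sum>i\<in>UNIV. (real_of_int (k $ i) ^ 2) ^ r * A))"
      by (simp add: algebra_simps sum_distrib_left)
    also have "\<dots> \<le> real (Suc CARD('m)) ^ r * (S + (\<Sum>i\<in>(UNIV :: 'm set). S))"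
      by (intro mult_left_mono add_mono sum_mono one pow) auto
    also have "\<dots> = real (Suc CARD('m)) ^ Suc r * S"
      by (simp add: algebra_simps)
    finally show "A \<le> real (Suc CARD('m)) ^ Suc r * S / Q"
      using Q by (simp add: pos_le_divide_eq mult.commute)
  qed
  then have "Q * schwartz_seminorm N (torus_integral (torus_char k) f)
        \<le> Q * (real (schwartz_order_count TYPE('n) N) * (real (Suc CARD('m)) ^ Suc r * S / Q))"
    using Q by (intro mult_left_mono) auto
  also have "\<dots> = real (schwartz_order_count TYPE('n) N) * (real (Suc CARD('m)) ^ Suc r * S)"
    using Q by simp
  finally show ?thesis
    unfolding Q_def S_def by (simp only: mult_ac)
qed


section \<open>Summation over the dual lattice\<close>

lemma bounded_sums_inverse_one_plus_square:
  obtains S where "\<And>A :: int set. finite A \<Longrightarrow> (\<Sum>n\<in>A. 1 / (1 + (real_of_int n)\<^sup>2)) \<le> S"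
proof -
  define w where "w = (\<lambda>n. 1 / (1 + (real n)\<^sup>2))"
  have summable: "summable w"
  proof (rule summable_comparison_test')
    show "summable (\<lambda>n. inverse (real n ^ 2))"
      by (rule inverse_power_summable) simp
    show "norm (w n) \<le> inverse (real n ^ 2)" if "1 \<le> n" for n
      using that by (auto simp: w_def inverse_eq_divide intro!: frac_le)
  qed
  have half: "(\<Sum>n\<in>B. w n) \<le> suminf w" if "finite B" for B
    by (rule sum_le_suminf[OF summable that]) (simp add: w_def)
  have "(\<Sum>n\<in>A. 1 / (1 + (real_of_int n)\<^sup>2)) \<le> 2 * suminf w" if A: "finite A" for A
  proof -
    have "(\<Sum>n\<in>A. 1 / (1 + (real_of_int n)\<^sup>2))
        = (\<Sum>n\<in>{n\<in>A. 0 \<le> n}. w (nat \<bar>n\<bar>)) + (\<Sum>n\<in>{n\<in>A. \<not> 0 \<le> n}. w (nat \<bar>n\<bar>))"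
      unfolding w_def using A by (subst sum.inter_filter[symmetric] sum.union_disjoint[symmetric];
        force intro!: sum.cong)+
    also have "(\<Sum>n\<in>{n\<in>A. 0 \<le> n}. w (nat \<bar>n\<bar>)) = (\<Sum>n\<in>(\<lambda>n. nat \<bar>n\<bar>) ` {n\<in>A. 0 \<le> n}. w n)"
      by (subst sum.reindex) (auto simp: inj_on_def)
    also have "(\<Sum>n\<in>{n\<in>A. \<not> 0 \<le> n}. w (nat \<bar>n\<bar>)) = (\<Sum>n\<in>(\<lambda>n. nat \<bar>n\<bar>) ` {n\<in>A. \<not> 0 \<le> n}. w n)"
      by (subst sum.reindex) (auto simp: inj_on_def)
    finally show ?thesis
      using half[of "(\<lambda>n. nat \<bar>n\<bar>) ` {n\<in>A. 0 \<le> n}"] half[of "(\<lambda>n. nat \<bar>n\<bar>) ` {n\<in>A. \<not> 0 \<le> n}"] A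
      by simp
  qed
  then show ?thesis
    using that by blast
qed

text \<open>Each of the \<open>m\<close> factors \<open>1 + |k|\<^sup>2\<close> is at least \<open>1 + k\<^sub>i\<^sup>2\<close> for its own \<open>i\<close>. Over a box, the sum of
  the reciprocals of \<open>\<Prod>\<^sub>i (1 + k\<^sub>i\<^sup>2)\<close> factors into one-dimensional sums, and every finite set lies in a box.\<close>

lemma summable_on_lattice:
  "(\<lambda>k :: int ^ 'm::finite. 1 / (1 + (norm (real_vec k))\<^sup>2) ^ CARD('m)) summable_on UNIV"
proof -
  let ?w = "\<lambda>n. 1 / (1 + (real_of_int n)\<^sup>2)"
  obtain S where S: "\<And>A :: int set. finite A \<Longrightarrow> (\<Sum>n\<in>A. ?w n) \<le> S"
    using bounded_sums_inverse_one_plus_square by blast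
  have dominated: "1 / (1 + (norm (real_vec k))\<^sup>2) ^ CARD('m) \<le> (\<Prod>i\<in>UNIV. ?w (k $ i))" for k :: "int ^ 'm"
  proof -
    have "(\<Prod>i\<in>UNIV. 1 + (real_of_int (k $ i))\<^sup>2) \<le> (\<Prod>i\<in>(UNIV :: 'm set). 1 + (norm (real_vec k))\<^sup>2)"
      unfolding norm_real_vec_sq by (intro prod_mono) (auto intro!: member_le_sum)
    moreover have "0 < (\<Prod>i\<in>UNIV. 1 + (real_of_int (k $ i))\<^sup>2)"
      by (intro prod_pos) (simp add: add_pos_nonneg)
    ultimately show ?thesis
      by (simp add: prod_dividef frac_le)
  qed
  have "(\<Sum>k\<in>F. 1 / (1 + (norm (real_vec k))\<^sup>2) ^ CARD('m)) \<le> S ^ CARD('m)"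
    if F: "finite F" for F :: "(int ^ 'm) set"
  proof -
    define A where "A = (\<Union>k\<in>F. range (vec_nth k))"
    have A: "finite A"
      unfolding A_def using F by auto
    have "(\<Sum>k\<in>F. 1 / (1 + (norm (real_vec k))\<^sup>2) ^ CARD('m)) \<le> (\<Sum>k\<in>F. \<Prod>i\<in>UNIV. ?w (k $ i))"
      by (intro sum_mono dominated)
    also have "\<dots> = (\<Sum>g\<in>vec_nth ` F. \<Prod>i\<in>UNIV. ?w (g i))"
      by (subst sum.reindex) (auto simp: inj_on_def vec_nth_inject)
    also have "\<dots> \<le> (\<Sum>g\<in>(\<Pi>\<^sub>E i\<in>(UNIV :: 'm set). A). \<Prod>i\<in>UNIV. ?w (g i))"
    proof (rule sum_mono2)
      show "finite (\<Pi>\<^sub>E i\<in>(UNIV :: 'm set). A)"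
        using A by (intro finite_PiE) auto
      show "vec_nth ` F \<subseteq> (\<Pi>\<^sub>E i\<in>(UNIV :: 'm set). A)"
        unfolding A_def by auto
    qed (intro prod_nonneg, simp)
    also have "\<dots> = (\<Prod>i\<in>(UNIV :: 'm set). \<Sum>n\<in>A. ?w n)"
      by (rule prod_sum_PiE[symmetric]) (use A in auto)
    also have "\<dots> = (\<Sum>n\<in>A. ?w n) ^ CARD('m)"
      by simp
    also have "\<dots> \<le> S ^ CARD('m)"
      by (intro power_mono S A sum_nonneg) simp
    finally show ?thesis .
  qed
  then show ?thesis
    by (intro nonneg_bdd_above_summable_on) (auto intro!: bdd_aboveI simp: add_nonneg_nonneg)
qed


section \<open>Continuity in the topology of the seminorms\<close>

text \<open>A Lipschitz estimate against a single seminorm places a subbasic ball of that seminorm around each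
  point of the preimage of an open set.\<close>

lemma continuous_map_seminorm_topology:
  assumes lip: "\<And>f g. f \<in> S \<Longrightarrow> g \<in> S \<Longrightarrow> cmod (v g - v f) \<le> K * p N (\<lambda>z. g z - f z)"
    and K: "0 \<le> K" and zero: "\<And>N. p N (\<lambda>z. 0) = 0"
  shows "continuous_map (seminorm_topology S p) euclidean v"
proof -
  let ?\<B> = "{{g \<in> S. p N (\<lambda>z. g z - f z) < e} | N f e. f \<in> S \<and> 0 < e}"
  have topspace: "topspace (seminorm_topology S p) = S"
    unfolding seminorm_topology_def topology_generated_by_topspace
  proof
    show "S \<subseteq> \<Union>?\<B>"
    proof
      fix f assume "f \<in> S"
      then have "{g \<in> S. p 0 (\<lambda>z. g z - f z) < 1} \<in> ?\<B>"
        by (intro CollectI exI[of _ 0] exI[of _ f] exI[of _ 1]) simp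
      moreover have "f \<in> {g \<in> S. p 0 (\<lambda>z. g z - f z) < 1}"
        using \<open>f \<in> S\<close> zero by simp
      ultimately show "f \<in> \<Union>?\<B>" by blast
    qed
  qed blast
  show ?thesis
    unfolding continuous_map_def topspace
  proof (intro conjI allI impI)
    fix U :: "complex set"
    assume "openin euclidean U"
    then have U: "open U" by simp
    show "openin (seminorm_topology S p) {f \<in> S. v f \<in> U}"
    proof (subst openin_subopen, intro ballI)
      fix f assume f: "f \<in> {f \<in> S. v f \<in> U}"
      then obtain e where e: "0 < e" "\<And>y. dist y (v f) < e \<Longrightarrow> y \<in> U"
        using U unfolding open_dist by blast
      define B where "B = {g \<in> S. p N (\<lambda>z. g z - f z) < e / (K + 1)}"
      have pos: "0 < e / (K + 1)"
        using e K by simp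
      have "openin (seminorm_topology S p) B"
        unfolding seminorm_topology_def B_def
        by (rule topology_generated_by_Basis) (use f pos in blast)
      moreover have "f \<in> B"
        unfolding B_def using f zero pos by simp
      moreover have "g \<in> {f \<in> S. v f \<in> U}" if "g \<in> B" for g
      proof -
        have g: "g \<in> S" "p N (\<lambda>z. g z - f z) < e / (K + 1)"
          using that unfolding B_def by auto
        have "cmod (v g - v f) \<le> K * p N (\<lambda>z. g z - f z)"
          using lip f g by simp
        also have "\<dots> \<le> K * (e / (K + 1))"
          using g(2) K by (intro mult_left_mono) auto
        also have "\<dots> < e"
          using e K by (simp add: field_simps)
        finally show ?thesis
          using e(2) g(1) by (simp add: dist_norm)
      qed
      ultimately show "\<exists>T. openin (seminorm_topology S p) T \<and> f \<in> T \<and> T \<subseteq> {f \<in> S. v f \<in> U}"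
        by blast
    qed
  qed simp
qed


section \<open>The distribution with prescribed Fourier coefficients\<close>

theorem proposition2p5:
  fixes u :: "int ^ 'm::finite \<Rightarrow> (real ^ 'n::finite \<Rightarrow> complex) \<Rightarrow> complex"
  assumes "\<And>k. u k \<in> tempered_distributions"
    and "\<exists>C::real. \<exists>N::nat. C > 0 \<and> N > 0 \<and>
           (\<forall>f\<in>schwartz. \<forall>k.
              cmod (u k f) \<le> C * schwartz_seminorm N f * (1 + (norm (real_vec k))\<^sup>2) powr (real N / 2))"
  shows "\<exists>!v. v \<in> torus_tempered_distributions \<and>
           (\<forall>f\<in>torus_schwartz.
              (\<lambda>k. u k (fourier_coeff f (- k))) summable_on UNIV \<and>
              v f = of_real ((2 * pi) ^ CARD('m)) * (\<Sum>\<^sub>\<infinity>k. u k (fourier_coeff f (- k))) \<and>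
              (\<forall>k. pairing_integrand (u k) k f integrable_on torus_cell) \<and>
              (\<lambda>k. exp_pairing (u k) k f) summable_on UNIV \<and>
              v f = (\<Sum>\<^sub>\<infinity>k. exp_pairing (u k) k f))"
proof -
  obtain C N where C: "0 < C" and bound: "\<And>f k. f \<in> schwartz \<Longrightarrow>
      cmod (u k f) \<le> C * schwartz_seminorm N f * (1 + (norm (real_vec k))\<^sup>2) powr (real N / 2)"
    using assms(2) by blast
  have lin: "schwartz_linear (u k)" for k
    by (rule tempered_distribution_schwartz_linear) (rule assms(1))
  define U where "U = (\<lambda>k f. u k (torus_integral (torus_char k) f))"
  note integral_schwartz = torus_integral_schwartz[OF _ continuous_torus_char norm_torus_char]

  have coeff: "u k (fourier_coeff f (- k)) = 1 / of_real ((2 * pi) ^ CARD('m)) * U k f"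
    if f: "f \<in> torus_schwartz" for k f
  proof -
    have I: "torus_integral (torus_char k) f \<in> schwartz"
      by (rule integral_schwartz[OF f])
    show ?thesis
      using schwartz_linearD[OF lin I I, of k "1 / of_real ((2 * pi) ^ CARD('m))" 0]
      unfolding fourier_coeff_eq U_def by (simp only: mult_zero_left add_0_right)
  qed
  have pairing: "(pairing_integrand (u k) k f has_integral U k f) torus_cell"
    if f: "f \<in> torus_schwartz" for k f
  proof -
    have "((\<lambda>t. u k (\<lambda>x. f (t, x)) * torus_char k t) has_integral U k f) torus_cell"
      unfolding U_def
    proof (rule has_integral_functional_slices[OF f continuous_torus_char norm_torus_char lin])
      show "0 \<le> C * (1 + (norm (real_vec k))\<^sup>2) powr (real N / 2)"
        using C by simp
      show "cmod (u k g) \<le> C * (1 + (norm (real_vec k))\<^sup>2) powr (real N / 2) * schwartz_seminorm N g"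
        if "g \<in> schwartz" for g
        using bound[OF that] by (simp add: mult_ac)
    qed
    then show ?thesis
      unfolding pairing_integrand_def torus_char_def .
  qed

  \<comment> \<open>Of the \<open>r\<close> powers of \<open>1 + |k|\<^sup>2\<close> gained, \<open>N\<close> absorb the growth allowed to \<open>u k\<close>, and the other
      \<open>m\<close> make the series converge.\<close>
  define r where "r = N + CARD('m)"
  define M where "M = 2 * r + N"
  define K where "K = C * (real (schwartz_order_count TYPE('n) N)
      * (real (Suc CARD('m)) ^ Suc r * (2 * pi) ^ CARD('m)))"
  define w where "w = (\<lambda>k :: int ^ 'm. 1 / (1 + (norm (real_vec k))\<^sup>2) ^ CARD('m))"
  have K: "0 \<le> K"
    unfolding K_def using C by simp
  have w: "w summable_on UNIV" "\<And>k. 0 \<le> w k"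
    unfolding w_def using summable_on_lattice by auto
  have U_le: "cmod (U k f) \<le> K * torus_seminorm M f * w k" if f: "f \<in> torus_schwartz" for k f
  proof -
    define q where "q = 1 + (norm (real_vec k))\<^sup>2"
    define p where "p = schwartz_seminorm N (torus_integral (torus_char k) f)"
    have q: "1 \<le> q"
      unfolding q_def by simp
    have "0 \<le> C * p * q powr (real N / 2)"
      using order_trans[OF norm_ge_zero bound[OF integral_schwartz[OF f]]] unfolding p_def q_def by blast
    then have p: "0 \<le> p"
      using C q by (simp add: zero_le_mult_iff)
    have "cmod (U k f) \<le> C * p * q powr (real N / 2)"
      unfolding U_def p_def q_def by (rule bound[OF integral_schwartz[OF f]])
    also have "\<dots> \<le> C * p * q ^ N"
    proof -
      have "q powr (real N / 2) \<le> q powr real N"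
        using q by (intro powr_mono) auto
      also have "\<dots> = q ^ N"
        using q by (simp add: powr_realpow)
      finally show ?thesis
        using C p by (intro mult_left_mono) auto
    qed
    also have "\<dots> = C * (q ^ r * p) * w k"
      using q unfolding r_def w_def q_def[symmetric] by (simp add: power_add)
    also have "\<dots> \<le> C * (real (schwartz_order_count TYPE('n) N)
        * (real (Suc CARD('m)) ^ Suc r * (2 * pi) ^ CARD('m)) * torus_seminorm M f) * w k"
      unfolding p_def q_def M_def
      using schwartz_seminorm_torus_integral_decay[OF f] C w(2)
      by (intro mult_right_mono mult_left_mono) auto
    also have "\<dots> = K * torus_seminorm M f * w k"
      unfolding K_def by (simp add: mult_ac)
    finally show ?thesis .
  qed
  have U_abs: "(\<lambda>k. cmod (U k f)) summable_on UNIV" if f: "f \<in> torus_schwartz" for f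
  proof (rule Infinite_Sum.abs_summable_on_comparison_test)
    show "(\<lambda>k. norm (K * torus_seminorm M f * w k)) summable_on UNIV"
      using w K torus_seminorm_nonneg[OF f] by (simp add: abs_mult summable_on_cmult_right)
    show "cmod (U k f) \<le> norm (K * torus_seminorm M f * w k)" for k
      using U_le[OF f, of k] by simp
  qed
  have U_sum: "(\<lambda>k. U k f) summable_on UNIV" if f: "f \<in> torus_schwartz" for f
    using U_abs[OF f] by (rule abs_summable_summable)
  have U_lin: "U k (\<lambda>z. a * f z + b * g z) = a * U k f + b * U k g"
    if fg: "f \<in> torus_schwartz" "g \<in> torus_schwartz" for k f g a b
  proof -
    have "torus_integral (torus_char k) (\<lambda>z. a * f z + b * g z)
        = (\<lambda>x. a * torus_integral (torus_char k) f x + b * torus_integral (torus_char k) g x)"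
      using fg by (intro torus_integral_lincomb continuous_torus_char) (auto simp: torus_schwartz_def)
    then show ?thesis
      unfolding U_def using schwartz_linearD[OF lin integral_schwartz[OF fg(1)] integral_schwartz[OF fg(2)]]
      by simp
  qed

  define v where "v = restrict (\<lambda>f. \<Sum>\<^sub>\<infinity>k. U k f) torus_schwartz"
  have v_lin: "v (\<lambda>z. a * f z + b * g z) = a * v f + b * v g"
    if fg: "f \<in> torus_schwartz" "g \<in> torus_schwartz" for f g a b
    using fg torus_schwartz_lincomb[OF fg, of a b] U_sum[OF fg(1)] U_sum[OF fg(2)]
    unfolding v_def by (simp add: U_lin infsum_add summable_on_cmult_right infsum_cmult_right)
  have v_le: "cmod (v f) \<le> K * (\<Sum>\<^sub>\<infinity>k. w k) * torus_seminorm M f" if f: "f \<in> torus_schwartz" for f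
  proof -
    have "cmod (v f) \<le> (\<Sum>\<^sub>\<infinity>k. cmod (U k f))"
      unfolding v_def using f norm_infsum_bound[OF U_abs[OF f]] by simp
    also have "\<dots> \<le> (\<Sum>\<^sub>\<infinity>k. K * torus_seminorm M f * w k)"
      by (intro infsum_mono U_abs[OF f] summable_on_cmult_right w U_le[OF f])
    also have "\<dots> = K * (\<Sum>\<^sub>\<infinity>k. w k) * torus_seminorm M f"
      using w by (simp add: infsum_cmult_right)
    finally show ?thesis .
  qed
  have v_dual: "v \<in> torus_tempered_distributions"
    unfolding torus_tempered_distributions_def topological_dual_def mem_Collect_eq
  proof (intro conjI ballI allI)
    show "v \<in> extensional torus_schwartz"
      unfolding v_def by simp
    show "v (\<lambda>z. f z + g z) = v f + v g" if "f \<in> torus_schwartz" "g \<in> torus_schwartz" for f g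
      using v_lin[OF that, of 1 1] by simp
    show "v (\<lambda>z. c * f z) = c * v f" if "f \<in> torus_schwartz" for c f
      using v_lin[OF that that, of c 0] by simp
    show "continuous_map (seminorm_topology torus_schwartz torus_seminorm) euclidean v"
    proof (rule continuous_map_seminorm_topology[where N = M and K = "K * (\<Sum>\<^sub>\<infinity>k. w k)"])
      fix f g :: "(real ^ 'm) \<times> (real ^ 'n) \<Rightarrow> complex"
      assume fg: "f \<in> torus_schwartz" "g \<in> torus_schwartz"
      then show "cmod (v g - v f) \<le> K * (\<Sum>\<^sub>\<infinity>k. w k) * torus_seminorm M (\<lambda>z. g z - f z)"
        using v_le[OF torus_schwartz_lincomb[OF fg(2,1), of 1 "-1"]] v_lin[OF fg(2,1), of 1 "-1"] by simp
    qed (use K w in \<open>auto simp: infsum_nonneg torus_seminorm_zero\<close>)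
  qed
  have v_formula: "(\<lambda>k. u k (fourier_coeff f (- k))) summable_on UNIV \<and>
      v f = of_real ((2 * pi) ^ CARD('m)) * (\<Sum>\<^sub>\<infinity>k. u k (fourier_coeff f (- k))) \<and>
      (\<forall>k. pairing_integrand (u k) k f integrable_on torus_cell) \<and>
      (\<lambda>k. exp_pairing (u k) k f) summable_on UNIV \<and>
      v f = (\<Sum>\<^sub>\<infinity>k. exp_pairing (u k) k f)" if f: "f \<in> torus_schwartz" for f
  proof -
    let ?V = "complex_of_real ((2 * pi) ^ CARD('m))"
    have coeffs: "(\<lambda>k. u k (fourier_coeff f (- k))) = (\<lambda>k. 1 / ?V * U k f)"
      using coeff[OF f] by (rule ext)
    have pairings: "(\<lambda>k. exp_pairing (u k) k f) = (\<lambda>k. U k f)"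
      unfolding exp_pairing_def by (rule ext) (rule integral_unique[OF pairing[OF f]])
    have "c * (1 / c * X) = X" if "c \<noteq> 0" for c X :: complex
      using that by simp
    from this[of ?V] have "v f = ?V * (1 / ?V * (\<Sum>\<^sub>\<infinity>k. U k f))"
      unfolding v_def using f by simp
    then show ?thesis
      unfolding coeffs pairings infsum_cmult_right'
      using pairing[OF f] U_sum[OF f] summable_on_cmult_right[OF U_sum[OF f], of "1 / ?V"] f
      by (auto simp: v_def)
  qed
  show ?thesis
  proof (rule ex1I[of _ v])
    fix v'
    assume v': "v' \<in> torus_tempered_distributions \<and>
           (\<forall>f\<in>torus_schwartz.
              (\<lambda>k. u k (fourier_coeff f (- k))) summable_on UNIV \<and>
              v' f = of_real ((2 * pi) ^ CARD('m)) * (\<Sum>\<^sub>\<infinity>k. u k (fourier_coeff f (- k))) \<and>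
              (\<forall>k. pairing_integrand (u k) k f integrable_on torus_cell) \<and>
              (\<lambda>k. exp_pairing (u k) k f) summable_on UNIV \<and>
              v' f = (\<Sum>\<^sub>\<infinity>k. exp_pairing (u k) k f))"
    have ext: "v' \<in> extensional torus_schwartz" "v \<in> extensional torus_schwartz"
      using v' v_dual unfolding torus_tempered_distributions_def topological_dual_def by auto
    show "v' = v"
      by (rule extensionalityI[OF ext]) (use v' v_formula in metis)
  qed (use v_dual v_formula in blast)
qed

end
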